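(* For all positive integers $k,n$, the reduced level-rank map with $N=1$, $$\bar\tau:\mathcal H_k(kn,1)_{\mathfrak{sl}_k[z]}\longrightarrow\mathcal H_1(n,k),$$ is an isomorphism.
   Context: For positive integers $M,p,\ell$ let $\mathbb C[X,A]$ be the polynomial ring in the entries of an $M\times M$ matrix $X$ and a $p\times M$ matrix $A$, and $\mathcal H_M(p,\ell)=\{f: f(gXg^{-1},Ag^{-1})=\det(g)^{-\ell}f(X,A)\ \forall g\in GL_M(\mathbb C)\}$. $\mathfrak{gl}_p[z]$ acts on it by $E^a_b\otimes z^m\mapsto\sum_{i,j}A^a_i(X^m)^i_j\,\partial/\partial A^b_j$. With $\mathbb C^{kn}=\mathbb C^n\otimes\mathbb C^k$, $\mathfrak{sl}_k[z]\subset\mathfrak{gl}_{kn}[z]$ via $y\otimes z^m\mapsto(1_n\otimes y)z^m$, and $\mathcal H_k(kn,1)_{\mathfrak{sl}_k[z]}=\mathcal H_k(kn,1)/\mathfrak{sl}_k[z]\cdot\mathcal H_k(kn,1)$. The level-rank map $\tau:\mathcal H_k(kn,1)\to\mathcal H_1(n,k)$ is $\tau(f)(x,A)=f(x\cdot1_k,A\otimes1_k)$ (Kronecker product; $x$ is a scalar variable, $A$ is $n\times1$). It annihilates $\mathfrak{sl}_k[z]\cdot\mathcal H_k(kn,1)$, and $\bar\tau$ is the induced map on coinvariants. *)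

theory Defs
  imports "HOL-Analysis.Analysis" "HOL-Library.Poly_Mapping" "HOL-Library.Set_Algebras"
begin

section \<open>Polynomials over the complex numbers in a set of named variables\<close>

text \<open>A monomial is a finitely supported exponent function, a polynomial a finitely supported
  coefficient function on monomials; the ring structure is the convolution product of
  \<^theory>\<open>HOL-Library.Poly_Mapping\<close>.\<close>

type_synonym 'v mpoly = "('v \<Rightarrow>\<^sub>0 nat) \<Rightarrow>\<^sub>0 complex"

definition Const :: "complex \<Rightarrow> 'v mpoly" where
  "Const c = Poly_Mapping.single 0 c"

definition Var :: "'v \<Rightarrow> 'v mpoly" where
  "Var v = Poly_Mapping.single (Poly_Mapping.single v 1) 1"

definition cscale :: "complex \<Rightarrow> 'v mpoly \<Rightarrow> 'v mpoly" where
  "cscale c f = Const c * f"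

interpretation mpoly: vector_space "cscale :: complex \<Rightarrow> 'v mpoly \<Rightarrow> 'v mpoly"
  by standard
    (simp_all add: cscale_def Const_def distrib_left distrib_right single_add
      mult_single flip: mult.assoc)

definition subst :: "('v \<Rightarrow> 'w mpoly) \<Rightarrow> 'v mpoly \<Rightarrow> 'w mpoly" where
  "subst \<phi> f = (\<Sum>m\<in>Poly_Mapping.keys f. Const (Poly_Mapping.lookup f m) *
     (\<Prod>v\<in>Poly_Mapping.keys m. \<phi> v ^ Poly_Mapping.lookup m v))"

text \<open>Formal partial derivative.  If \<open>v\<close> does not occur in \<open>m\<close>, then the truncated
  difference of exponents is irrelevant because the coefficient is \<open>0\<close>.\<close>

definition partial :: "'v \<Rightarrow> 'v mpoly \<Rightarrow> 'v mpoly" where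
  "partial v f = (\<Sum>m\<in>Poly_Mapping.keys f.
     Poly_Mapping.single (m - Poly_Mapping.single v 1)
       (of_nat (Poly_Mapping.lookup m v) * Poly_Mapping.lookup f m))"


section \<open>Relative invariants\<close>

text \<open>The positive integers \<open>M\<close> and \<open>p\<close> are the cardinalities of finite index types
  \<open>'m\<close> and \<open>'p\<close>.  \<open>XV i j\<close> stands for $X^i_j$ (row \<open>i\<close>, column \<open>j\<close>) and
  \<open>AV a i\<close> for $A^a_i$ (row \<open>a\<close>, column \<open>i\<close>).\<close>

datatype ('m, 'p) var = XV 'm 'm | AV 'p 'm

type_synonym ('m, 'p) xapoly = "('m, 'p) var mpoly"

definition Xmat :: "('m::finite, 'p::finite) xapoly ^ 'm ^ 'm" where
  "Xmat = (\<chi> i j. Var (XV i j))"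

definition Amat :: "('m::finite, 'p::finite) xapoly ^ 'm ^ 'p" where
  "Amat = (\<chi> a i. Var (AV a i))"

definition Cmat :: "complex ^ 'n ^ 'm \<Rightarrow> 'v mpoly ^ 'n ^ 'm" where
  "Cmat g = (\<chi> i j. Const (g $ i $ j))"

text \<open>\<open>eval_XA P Q f\<close> is \<open>f(P, Q)\<close>.\<close>

definition eval_XA ::
  "'w mpoly ^ 'm ^ 'm \<Rightarrow> 'w mpoly ^ 'm ^ 'p \<Rightarrow> ('m::finite, 'p::finite) xapoly \<Rightarrow> 'w mpoly" where
  "eval_XA P Q = subst (\<lambda>v. case v of XV i j \<Rightarrow> P $ i $ j | AV a i \<Rightarrow> Q $ a $ i)"

text \<open>$\mathcal H_M(p,\ell)$\<close>

definition HH :: "nat \<Rightarrow> ('m::finite, 'p::finite) xapoly set" where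
  "HH l = {f. \<forall>g :: complex ^ 'm ^ 'm. invertible g \<longrightarrow>
     eval_XA (Cmat g ** Xmat ** Cmat (matrix_inv g)) (Amat ** Cmat (matrix_inv g)) f =
       cscale (det g powi (- int l)) f}"


section \<open>The current algebra action and coinvariants\<close>

definition matrix_pow :: "'a::semiring_1 ^ 'm ^ 'm \<Rightarrow> nat \<Rightarrow> 'a ^ 'm ^ 'm" where
  "matrix_pow B n = (((**) B) ^^ n) (mat 1)"

text \<open>\<open>current_act Y m\<close> is the operator by which $Y\otimes z^m\in\mathfrak{gl}_p[z]$ acts,
  where $Y=\sum_{a,b} Y_{ab}E^a_b$ and $E^a_b$ is the matrix unit in row \<open>a\<close> and column \<open>b\<close>.\<close>

definition current_act ::
  "complex ^ 'p ^ 'p \<Rightarrow> nat \<Rightarrow> ('m::finite, 'p::finite) xapoly \<Rightarrow> ('m, 'p) xapoly" where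
  "current_act Y m f = (\<Sum>a\<in>UNIV. \<Sum>b\<in>UNIV. cscale (Y $ a $ b)
     (\<Sum>i\<in>UNIV. \<Sum>j\<in>UNIV. Amat $ a $ i * matrix_pow Xmat m $ i $ j * partial (AV b j) f))"

definition kronecker :: "'a::times ^ 'n ^ 'm \<Rightarrow> 'a ^ 's ^ 'r \<Rightarrow> 'a ^ ('n \<times> 's) ^ ('m \<times> 'r)" where
  "kronecker B D = (\<chi> r c. B $ fst r $ fst c * D $ snd r $ snd c)"

text \<open>The index type \<open>'n \<times> 'k\<close> realises $\mathbb C^{kn}=\mathbb C^n\otimes\mathbb C^k$.
  The subspace $\mathfrak{sl}_k[z]\cdot\mathcal H_k(kn,1)$ is spanned by the images under the
  elements $y\otimes z^m$, since these span $\mathfrak{sl}_k[z]$.\<close>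

definition slk_HH :: "('k::finite, 'n::finite \<times> 'k) xapoly set" where
  "slk_HH = mpoly.span
     {current_act (kronecker (mat 1) y) m f | (y :: complex ^ 'k ^ 'k) m f. trace y = 0 \<and> f \<in> HH 1}"

text \<open>Vectors of a quotient space \<open>V/W\<close> are the cosets \<open>f +o W\<close> with \<open>f \<in> V\<close>.  Their sum is the
  elementwise sum of sets; in the scalar multiple, \<open>W\<close> is added so that \<open>0 \<cdot> (f + W)\<close> is \<open>W\<close>.\<close>

definition quotient_space :: "'v mpoly set \<Rightarrow> 'v mpoly set \<Rightarrow> 'v mpoly set set" where
  "quotient_space V W = (\<lambda>f. f +o W) ` V"

definition quotient_scale :: "'v mpoly set \<Rightarrow> complex \<Rightarrow> 'v mpoly set \<Rightarrow> 'v mpoly set" where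
  "quotient_scale W c C = cscale c ` C + W"

definition quotient_linear_iso ::
  "'v mpoly set \<Rightarrow> 'v mpoly set \<Rightarrow> 'w mpoly set \<Rightarrow> ('v mpoly set \<Rightarrow> 'w mpoly) \<Rightarrow> bool" where
  "quotient_linear_iso V W U \<phi> \<longleftrightarrow>
     bij_betw \<phi> (quotient_space V W) U \<and>
     (\<forall>C\<in>quotient_space V W. \<forall>D\<in>quotient_space V W. \<phi> (C + D) = \<phi> C + \<phi> D) \<and>
     (\<forall>c. \<forall>C\<in>quotient_space V W. \<phi> (quotient_scale W c C) = cscale c (\<phi> C))"


section \<open>The level-rank map\<close>

text \<open>In the target the size of \<open>X\<close> is one, with index type \<open>1\<close>; accordingly the column index
  \<open>(1, j)\<close> of $A\otimes 1_k$ is identified with \<open>j\<close>.\<close>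

definition level_rank :: "('k::finite, 'n::finite \<times> 'k) xapoly \<Rightarrow> (1, 'n) xapoly" where
  "level_rank = eval_XA (mat (Var (XV 1 1)))
     (\<chi> r j. kronecker Amat (mat 1 :: (1, 'n) xapoly ^ 'k ^ 'k) $ r $ (1, j))"

text \<open>The induced map sends a coset to the common value of \<^const>\<open>level_rank\<close> on its elements.\<close>

definition level_rank_bar :: "('k::finite, 'n::finite \<times> 'k) xapoly set \<Rightarrow> (1, 'n) xapoly" where
  "level_rank_bar C = the_elem (level_rank ` C)"

end

theory Submission
  imports Defs
begin

text \<open>
  An \<open>f\<close> in $\mathcal H_k(p,1)$ is determined by its restriction to diagonal \<open>X\<close>, because the
  diagonalizable matrices are dense.  Invariance under the torus makes the restriction linear in each
  column of \<open>A\<close>, and invariance under permutation matrices makes it alternating.  Hence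
  $\mathcal H_k(p,1)$ is spanned by the determinants with rows $A^{r_i}X^{e_i}$.

  For $p = kn$ a row index is a pair $(u_i, c_i)$ with a colour $c_i \in \{1,\dots,k\}$.  Modulo
  $\mathfrak{sl}_k[z]$ the Cartan subalgebra kills every determinant in which a colour is missing;
  otherwise the rows can be sorted so that $c_i = i$.  Applying $E^p_q \otimes z^s$ to a determinant in
  which colour \<open>q\<close> occurs twice and \<open>p\<close> does not, one may exchange two labels $u_i$ and move powers
  of \<open>X\<close> between rows.  So the class depends only on the multiset of the $u_i$ and on $\sum e_i$, and
  the level-rank map sends it to the monomial $x^{\sum e_i}\prod_i a_{u_i}$.
\<close>

section \<open>Ring homomorphisms and matrices\<close>

text \<open>Injectivity would seem to require a basis of the coinvariants. The obstacle is avoided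
  by a linear map in the other direction: each monomial goes to one chosen sorted determinant, and
  \<open>f\<close> is congruent to the image of \<open>level_rank f\<close> under this map. Both
  sides are linear in \<open>f\<close>, so it suffices to compare them on the spanning determinants,
  and no linear independence of determinants is ever proved. The same spanning theorem carries the
  vanishing of the level-rank map on the image of sl_k[z]: on determinants it becomes the formula
  for the derivative of det(B(1 + tY)) at t = 0, whose value contains the trace of Y. The group GL_M
  enters through very few elements. A torus condition on exponents is read off from a single
  diagonal matrix with entries 1/2 and 1, because distinct powers of 2 are distinct; beyond that
  only permutation matrices, scalars and the matrices that diagonalize X are used.\<close>

definition mmap :: "('a \<Rightarrow> 'b) \<Rightarrow> 'a ^ 'n ^ 'm \<Rightarrow> 'b ^ 'n ^ 'm" where
  "mmap h B = (\<chi> i j. h (B $ i $ j))"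

lemma mmap_nth [simp]: "mmap h B $ i $ j = h (B $ i $ j)"
  by (simp add: mmap_def)

lemma matrix_pow_0 [simp]: "matrix_pow B 0 = mat 1"
  by (simp add: matrix_pow_def)

lemma matrix_pow_Suc: "matrix_pow B (Suc n) = B ** matrix_pow B n"
  by (simp add: matrix_pow_def)

locale ring_hom_comm =
  fixes F :: "'a::comm_ring_1 \<Rightarrow> 'b::comm_ring_1"
  assumes F_add: "F (a + b) = F a + F b"
    and F_mult: "F (a * b) = F a * F b"
    and F_1: "F 1 = 1"
begin

lemma F_0: "F 0 = 0"
  using F_add[of 0 0] by simp

lemma F_uminus: "F (- a) = - F a"
  using F_add[of "- a" a] by (simp add: F_0 eq_neg_iff_add_eq_0)

lemma F_diff: "F (a - b) = F a - F b"
  using F_add[of a "- b"] by (simp add: F_uminus)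

lemma F_sum: "F (sum f S) = (\<Sum>x\<in>S. F (f x))"
  by (induction S rule: infinite_finite_induct) (simp_all add: F_0 F_add)

lemma F_prod: "F (prod f S) = (\<Prod>x\<in>S. F (f x))"
  by (induction S rule: infinite_finite_induct) (simp_all add: F_1 F_mult)

lemma F_power: "F (a ^ n) = F a ^ n"
  by (induction n) (simp_all add: F_1 F_mult)

lemma F_of_int: "F (of_int n) = of_int n"
proof -
  have "F (of_nat n) = of_nat n" for n
    by (induction n) (simp_all add: F_0 F_1 F_add)
  then show ?thesis
    by (cases n) (simp_all add: F_uminus del: of_nat_Suc)
qed

lemma F_det: "F (det B) = det (mmap F B)"
  by (simp add: det_def F_sum F_mult F_of_int F_prod)

lemma mmap_mult: "mmap F (A ** B) = mmap F A ** mmap F B"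
  by (simp add: vec_eq_iff matrix_matrix_mult_def F_sum F_mult)

lemma mmap_mat_1: "mmap F (mat 1) = mat 1"
  by (simp add: vec_eq_iff mat_def F_0 F_1)

lemma mmap_matrix_pow: "mmap F (matrix_pow B n) = matrix_pow (mmap F B) n"
  by (induction n) (simp_all add: matrix_pow_Suc mmap_mult mmap_mat_1)

end

section \<open>Polynomials\<close>

lemma poly_mapping_eq_sum_single:
  "f = (\<Sum>m\<in>Poly_Mapping.keys f. Poly_Mapping.single m (Poly_Mapping.lookup f m))"
  by (rule poly_mapping_eqI)
    (simp add: lookup_sum lookup_single when_def sum.delta in_keys_iff)

definition monomial :: "('v \<Rightarrow> 'r::comm_ring_1) \<Rightarrow> ('v \<Rightarrow>\<^sub>0 nat) \<Rightarrow> 'r" where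
  "monomial \<phi> m = (\<Prod>v\<in>Poly_Mapping.keys m. \<phi> v ^ Poly_Mapping.lookup m v)"

lemma monomial_superset:
  assumes "finite S" "Poly_Mapping.keys m \<subseteq> S"
  shows "monomial \<phi> m = (\<Prod>v\<in>S. \<phi> v ^ Poly_Mapping.lookup m v)"
  unfolding monomial_def
  by (rule prod.mono_neutral_left) (use assms in \<open>auto simp: in_keys_iff\<close>)

lemma monomial_0 [simp]: "monomial \<phi> 0 = 1"
  by (simp add: monomial_def)

lemma monomial_single [simp]: "monomial \<phi> (Poly_Mapping.single v n) = \<phi> v ^ n"
  by (cases "n = 0") (simp_all add: monomial_def)

lemma monomial_add: "monomial \<phi> (m + n) = monomial \<phi> m * monomial \<phi> n"
proof -
  let ?S = "Poly_Mapping.keys m \<union> Poly_Mapping.keys n"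
  have "Poly_Mapping.keys (m + n) \<subseteq> ?S" by (rule keys_add)
  then show ?thesis
    by (simp add: monomial_superset[of ?S] lookup_add power_add prod.distrib)
qed

lemma monomial_sum:
  "monomial \<phi> (sum m S) = (\<Prod>x\<in>S. monomial \<phi> (m x))"
  by (induction S rule: infinite_finite_induct) (simp_all add: monomial_add)

text \<open>The coefficient map \<open>h\<close> serves two purposes: with \<open>Const\<close> this
  is \<open>subst\<close>, with the identity of the complex numbers it is evaluation at a point. All
  homomorphism facts are proved once for both.\<close>

definition polyeval :: "(complex \<Rightarrow> 'r::comm_ring_1) \<Rightarrow> ('v \<Rightarrow> 'r) \<Rightarrow> 'v mpoly \<Rightarrow> 'r" where
  "polyeval h \<phi> f = (\<Sum>m\<in>Poly_Mapping.keys f. h (Poly_Mapping.lookup f m) * monomial \<phi> m)"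

locale coefficient_hom =
  fixes h :: "complex \<Rightarrow> 'r::comm_ring_1"
  assumes h_add: "h (a + b) = h a + h b"
    and h_mult: "h (a * b) = h a * h b"
    and h_1: "h 1 = 1"
begin

sublocale hh: ring_hom_comm h
  by standard (simp_all add: h_add h_mult h_1)

lemmas h_0 = hh.F_0

lemma polyeval_superset:
  assumes "finite S" "Poly_Mapping.keys f \<subseteq> S"
  shows "polyeval h \<phi> f = (\<Sum>m\<in>S. h (Poly_Mapping.lookup f m) * monomial \<phi> m)"
  unfolding polyeval_def
  by (rule sum.mono_neutral_left) (use assms in \<open>auto simp: in_keys_iff h_0\<close>)

lemma polyeval_add: "polyeval h \<phi> (f + g) = polyeval h \<phi> f + polyeval h \<phi> g"
proof -
  let ?S = "Poly_Mapping.keys f \<union> Poly_Mapping.keys g"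
  have "Poly_Mapping.keys (f + g) \<subseteq> ?S" by (rule keys_add)
  then show ?thesis
    by (simp add: polyeval_superset[of ?S] lookup_add h_add distrib_right sum.distrib)
qed

lemma polyeval_0 [simp]: "polyeval h \<phi> 0 = 0"
  by (simp add: polyeval_def)

lemma polyeval_sum: "polyeval h \<phi> (sum f S) = (\<Sum>x\<in>S. polyeval h \<phi> (f x))"
  by (induction S rule: infinite_finite_induct) (simp_all add: polyeval_add)

lemma polyeval_single: "polyeval h \<phi> (Poly_Mapping.single m c) = h c * monomial \<phi> m"
  by (cases "c = 0") (simp_all add: polyeval_def h_0)

lemma polyeval_mult: "polyeval h \<phi> (f * g) = polyeval h \<phi> f * polyeval h \<phi> g"
proof -
  let ?f = "\<lambda>m. Poly_Mapping.single m (Poly_Mapping.lookup f m)"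
  let ?g = "\<lambda>m. Poly_Mapping.single m (Poly_Mapping.lookup g m)"
  have "f * g = (\<Sum>m\<in>Poly_Mapping.keys f. \<Sum>n\<in>Poly_Mapping.keys g. ?f m * ?g n)"
    by (subst poly_mapping_eq_sum_single[of f], subst poly_mapping_eq_sum_single[of g])
      (simp add: sum_product)
  then have "polyeval h \<phi> (f * g) =
      (\<Sum>m\<in>Poly_Mapping.keys f. \<Sum>n\<in>Poly_Mapping.keys g.
        polyeval h \<phi> (?f m) * polyeval h \<phi> (?g n))"
    by (simp add: polyeval_sum mult_single polyeval_single monomial_add h_mult mult_ac)
  also have "\<dots> = polyeval h \<phi> (sum ?f (Poly_Mapping.keys f)) *
      polyeval h \<phi> (sum ?g (Poly_Mapping.keys g))"
    by (simp add: polyeval_sum sum_product)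
  finally show ?thesis
    by (simp flip: poly_mapping_eq_sum_single)
qed

lemma polyeval_Const [simp]: "polyeval h \<phi> (Const c) = h c"
  by (simp add: Const_def polyeval_single)

lemma polyeval_1 [simp]: "polyeval h \<phi> 1 = 1"
  using polyeval_single[of \<phi> 0 1] by (simp add: h_1)

lemma polyeval_Var [simp]: "polyeval h \<phi> (Var v) = \<phi> v"
  by (simp add: Var_def polyeval_single h_1)

sublocale pe: ring_hom_comm "polyeval h \<phi>" for \<phi>
  by standard (simp_all add: polyeval_add polyeval_mult)

lemma polyeval_det:
  "polyeval h \<phi> (det B) = det (\<chi> i j. polyeval h \<phi> (B $ i $ j))"
  by (simp add: pe.F_det mmap_def)

end

interpretation Const: coefficient_hom "Const :: complex \<Rightarrow> 'w mpoly"
  by standard (simp_all add: Const_def single_add mult_single)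

interpretation pt: coefficient_hom "\<lambda>c::complex. c"
  by standard simp_all

lemma subst_eq_polyeval: "subst = polyeval Const"
  by (intro ext) (simp add: subst_def polyeval_def monomial_def)

lemma single_eq_monomial: "Poly_Mapping.single m c = Const c * monomial Var m"
proof -
  have m: "m = (\<Sum>v\<in>Poly_Mapping.keys m. Poly_Mapping.single v (Poly_Mapping.lookup m v))"
    by (rule poly_mapping_eq_sum_single)
  have pow: "Var v ^ n = Poly_Mapping.single (Poly_Mapping.single v n) 1" for v :: 'a and n
  proof (induction n)
    case (Suc n)
    then show ?case
      by (simp add: Var_def mult_single flip: single_add)
  qed simp
  have sum: "(\<Prod>v\<in>S. Poly_Mapping.single (f v) (1::complex)) = Poly_Mapping.single (sum f S) 1"
    for f :: "'a \<Rightarrow> 'a \<Rightarrow>\<^sub>0 nat" and S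
    by (induction S rule: infinite_finite_induct) (simp_all add: mult_single)
  have "monomial Var m = Poly_Mapping.single m (1::complex)"
    by (simp add: monomial_def pow sum flip: m)
  then show ?thesis
    by (simp add: Const_def mult_single)
qed

lemma mpoly_induct [case_names Const Var add mult]:
  assumes C: "\<And>c. P (Const c)" and V: "\<And>v. P (Var v)"
    and A: "\<And>f g. P f \<Longrightarrow> P g \<Longrightarrow> P (f + g)"
    and M: "\<And>f g. P f \<Longrightarrow> P g \<Longrightarrow> P (f * g)"
  shows "P (f :: 'v mpoly)"
proof -
  have 0: "P 0" and 1: "P 1"
    using C[of 0] C[of 1] by (simp_all add: Const_def)
  have sum: "P (sum F S)" if "\<And>x. P (F x)" for F :: "('v \<Rightarrow>\<^sub>0 nat) \<Rightarrow> 'v mpoly" and S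
    using that by (induction S rule: infinite_finite_induct) (simp_all add: 0 A)
  have prod: "P (prod F S)" if "\<And>x. P (F x)" for F :: "'v \<Rightarrow> 'v mpoly" and S
    using that by (induction S rule: infinite_finite_induct) (simp_all add: 1 M)
  have pow: "P (g ^ n)" if "P g" for g n
    using that by (induction n) (simp_all add: 1 M)
  have "P (Poly_Mapping.single m c)" for m c
    unfolding single_eq_monomial monomial_def by (intro M C prod pow V)
  then show ?thesis
    by (subst poly_mapping_eq_sum_single) (rule sum)
qed

lemma (in coefficient_hom) polyeval_subst:
  "polyeval h \<psi> (polyeval Const \<phi> f) = polyeval h (\<lambda>v. polyeval h \<psi> (\<phi> v)) f"
  by (induction f rule: mpoly_induct)
    (simp_all add: polyeval_add polyeval_mult Const.polyeval_add Const.polyeval_mult)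

lemma lookup_cscale [simp]: "Poly_Mapping.lookup (cscale c f) m = c * Poly_Mapping.lookup f m"
proof -
  have "cscale c f = (\<Sum>m\<in>Poly_Mapping.keys f. Poly_Mapping.single m (c * Poly_Mapping.lookup f m))"
    by (subst poly_mapping_eq_sum_single[of f])
      (simp add: cscale_def Const_def sum_distrib_left mult_single)
  then show ?thesis
    by (simp add: lookup_sum lookup_single when_def sum.delta in_keys_iff)
qed

text \<open>A rescaling of the variables is diagonal in the monomial basis. Hence an eigenvector
  equation for it becomes a condition on every single monomial that occurs; all torus arguments are
  of this kind.\<close>

lemma lookup_scale_vars:
  "Poly_Mapping.lookup (polyeval Const (\<lambda>v. Const (t v) * Var v) f) m =
     monomial t m * Poly_Mapping.lookup f m"
proof -
  have mon: "monomial (\<lambda>v. Const (t v) * Var v) m = Const (monomial t m) * monomial Var m"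
    for m :: "'a \<Rightarrow>\<^sub>0 nat"
  proof -
    have "Const (monomial t m) = (monomial (\<lambda>v. Const (t v)) m :: 'a mpoly)"
    proof -
      have "monomial t m = polyeval (\<lambda>c. c) t (Poly_Mapping.single m 1)"
        by (simp add: pt.polyeval_single)
      have p: "Const (a ^ n) = (Const a ^ n :: 'a mpoly)" for a n
        by (induction n) (simp_all add: Const.h_mult Const.h_1)
      have "Const (prod F S) = (\<Prod>x\<in>S. Const (F x) :: 'a mpoly)" for F :: "'a \<Rightarrow> complex" and S
        by (induction S rule: infinite_finite_induct) (simp_all add: Const.h_mult Const.h_1)
      then show ?thesis
        by (simp add: monomial_def p)
    qed
    then show ?thesis
      by (simp add: monomial_def power_mult_distrib prod.distrib)
  qed
  have "polyeval Const (\<lambda>v. Const (t v) * Var v) f =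
      (\<Sum>m\<in>Poly_Mapping.keys f. Poly_Mapping.single m (monomial t m * Poly_Mapping.lookup f m))"
    unfolding polyeval_def mon
    by (rule sum.cong) (simp_all add: single_eq_monomial Const.h_mult mult_ac)
  then show ?thesis
    by (simp add: lookup_sum lookup_single when_def sum.delta in_keys_iff)
qed

section \<open>Formal partial derivatives: Leibniz rule, coefficients and chain rule along a
  line\<close>

lemma partial_superset:
  assumes "finite S" "Poly_Mapping.keys f \<subseteq> S"
  shows "partial v f = (\<Sum>m\<in>S. Poly_Mapping.single (m - Poly_Mapping.single v 1)
       (of_nat (Poly_Mapping.lookup m v) * Poly_Mapping.lookup f m))"
  unfolding partial_def
  by (rule sum.mono_neutral_left) (use assms in \<open>auto simp: in_keys_iff\<close>)

lemma partial_add: "partial v (f + g) = partial v f + partial v g"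
proof -
  let ?S = "Poly_Mapping.keys f \<union> Poly_Mapping.keys g"
  have "Poly_Mapping.keys (f + g) \<subseteq> ?S" by (rule keys_add)
  then show ?thesis
    by (simp add: partial_superset[of ?S] lookup_add distrib_left single_add sum.distrib)
qed

lemma partial_0 [simp]: "partial v 0 = 0"
  by (simp add: partial_def)

lemma partial_sum: "partial v (sum f S) = (\<Sum>x\<in>S. partial v (f x))"
  by (induction S rule: infinite_finite_induct) (simp_all add: partial_add)

lemma partial_single:
  "partial v (Poly_Mapping.single m c) =
    Poly_Mapping.single (m - Poly_Mapping.single v 1) (of_nat (Poly_Mapping.lookup m v) * c)"
  by (cases "c = 0") (simp_all add: partial_def)

text \<open>Subtraction of exponents is truncated, so it commutes with addition only if
  \<open>v\<close> occurs in \<open>m\<close>. In the Leibniz rule the other case carries the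
  coefficient 0.\<close>

lemma single_diff_add:
  assumes "Poly_Mapping.lookup m v \<noteq> (0::nat)"
  shows "m + n - Poly_Mapping.single v 1 = (m - Poly_Mapping.single v 1) + n"
  by (rule poly_mapping_eqI) (use assms in \<open>auto simp: lookup_add lookup_minus lookup_single when_def\<close>)

lemma partial_mult_single:
  "partial v (Poly_Mapping.single m c * Poly_Mapping.single n d) =
     partial v (Poly_Mapping.single m c) * Poly_Mapping.single n d +
     Poly_Mapping.single m c * partial v (Poly_Mapping.single n d)"
proof -
  have 1: "Poly_Mapping.single (m + n - Poly_Mapping.single v 1) (of_nat (Poly_Mapping.lookup m v) * c * d) =
    Poly_Mapping.single (m - Poly_Mapping.single v 1 + n) (of_nat (Poly_Mapping.lookup m v) * c * d)"
    by (cases "Poly_Mapping.lookup m v = 0") (auto simp: single_diff_add simp del: One_nat_def)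
  have 2: "Poly_Mapping.single (m + n - Poly_Mapping.single v 1) (of_nat (Poly_Mapping.lookup n v) * c * d) =
    Poly_Mapping.single (m + (n - Poly_Mapping.single v 1)) (of_nat (Poly_Mapping.lookup n v) * c * d)"
    by (cases "Poly_Mapping.lookup n v = 0") (auto simp: single_diff_add add.commute[of m] simp del: One_nat_def)
  show ?thesis
    using 1 2
    by (simp add: mult_single partial_single lookup_add distrib_right distrib_left single_add mult_ac
        add.commute[of n] del: One_nat_def)
qed

lemma partial_mult: "partial v (f * g) = partial v f * g + f * partial v g"
proof -
  let ?f = "\<lambda>m. Poly_Mapping.single m (Poly_Mapping.lookup f m)"
  let ?g = "\<lambda>m. Poly_Mapping.single m (Poly_Mapping.lookup g m)"
  have "partial v (sum ?f (Poly_Mapping.keys f) * sum ?g (Poly_Mapping.keys g)) =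
    partial v (sum ?f (Poly_Mapping.keys f)) * sum ?g (Poly_Mapping.keys g) +
    sum ?f (Poly_Mapping.keys f) * partial v (sum ?g (Poly_Mapping.keys g))"
    unfolding sum_product partial_sum partial_mult_single sum.distrib by simp
  then show ?thesis
    by (simp flip: poly_mapping_eq_sum_single)
qed

lemma partial_Const [simp]: "partial v (Const c) = 0"
  by (simp add: Const_def partial_single)

lemma partial_Var: "partial v (Var w) = (if v = w then 1 else 0)"
  by (auto simp: Var_def partial_single lookup_single when_def)

lemma lookup_partial:
  "Poly_Mapping.lookup (partial v f) m =
    of_nat (Suc (Poly_Mapping.lookup m v)) * Poly_Mapping.lookup f (m + Poly_Mapping.single v 1)"
proof -
  let ?e = "Poly_Mapping.single v (1::nat)"
  \<comment> \<open>If \<open>v\<close> is absent from \<open>n\<close>, truncation can make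
    \<open>n - ?e\<close> equal to \<open>m\<close> although \<open>n\<close> is not
    \<open>m + ?e\<close>; the factor 0 removes this term.\<close>
  have eq: "(of_nat (Poly_Mapping.lookup n v) * c when n - ?e = m) =
    ((of_nat (Suc (Poly_Mapping.lookup m v)) * c) when n = m + ?e)" for n and c :: complex
  proof (cases "Poly_Mapping.lookup n v = 0")
    case True
    then have "n \<noteq> m + ?e" by (auto simp: lookup_add)
    with True show ?thesis by simp
  next
    case False
    then have n: "n = n - ?e + ?e"
      by (intro poly_mapping_eqI) (auto simp: lookup_add lookup_minus lookup_single when_def)
    then have "n - ?e = m \<longleftrightarrow> n = m + ?e"
      by (metis add_right_cancel)
    moreover have "Poly_Mapping.lookup (m + ?e) v = Suc (Poly_Mapping.lookup m v)"
      by (simp add: lookup_add)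
    ultimately show ?thesis
      by (auto simp: when_def)
  qed
  show ?thesis
    unfolding partial_def
    by (simp add: lookup_sum lookup_single eq del: One_nat_def of_nat_Suc)
      (simp add: when_def sum.delta in_keys_iff del: One_nat_def of_nat_Suc)
qed

text \<open>The bridge from formal to analytic derivatives: vanishing on a short segment of a line
  yields a linear relation between the values of the formal partial derivatives.\<close>

lemma has_field_derivative_polyeval_line:
  fixes f :: "'v::finite mpoly"
  shows "((\<lambda>s. polyeval (\<lambda>c. c) (\<lambda>v. p v + s * d v) f) has_field_derivative
     (\<Sum>v\<in>UNIV. d v * polyeval (\<lambda>c. c) p (partial v f))) (at 0)"
proof (induction f rule: mpoly_induct)
  case (Const c)
  then show ?case by (simp)
next
  case (Var w)
  have "(\<Sum>v\<in>UNIV. d v * polyeval (\<lambda>c. c) p (partial v (Var w))) = d w"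
    by (simp add: partial_Var if_distrib[where f="polyeval _ _"] if_distrib[where f="(*) _"] cong: if_cong)
  then show ?case
    by (auto intro!: derivative_eq_intros)
next
  case (add f g)
  then show ?case
    by (auto simp: pt.polyeval_add partial_add distrib_left sum.distrib intro: DERIV_add)
next
  case (mult f g)
  show ?case
    using DERIV_mult[OF mult]
    by (simp add: pt.polyeval_mult pt.polyeval_add partial_mult distrib_left sum.distrib sum_distrib_left sum_distrib_right mult_ac)
qed

text \<open>A member of least total degree has vanishing partial derivatives, so it is constant.\<close>

lemma partial_closed_eq_0:
  fixes I :: "'v::finite mpoly set"
  assumes closed: "\<And>f v. f \<in> I \<Longrightarrow> partial v f \<in> I"
    and const: "\<And>c. Const c \<in> I \<Longrightarrow> c = 0"
    and "f \<in> I"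
  shows "f = 0"
proof -
  let ?deg = "\<lambda>m::'v \<Rightarrow>\<^sub>0 nat. \<Sum>v\<in>UNIV. Poly_Mapping.lookup m v"
  have *: "f = 0" if "f \<in> I" "\<And>m. Poly_Mapping.lookup f m \<noteq> 0 \<Longrightarrow> ?deg m < N" for f N
    using that
  proof (induction N arbitrary: f)
    case 0
    then show ?case by (metis lookup_zero not_less0 poly_mapping_eqI)
  next
    case (Suc N)
    have "partial v f = 0" for v
    proof (rule Suc.IH)
      show "partial v f \<in> I" by (rule closed[OF Suc.prems(1)])
      fix m assume "Poly_Mapping.lookup (partial v f) m \<noteq> 0"
      then have "Poly_Mapping.lookup f (m + Poly_Mapping.single v 1) \<noteq> 0"
        by (auto simp: lookup_partial)
      from Suc.prems(2)[OF this] show "?deg m < N"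
        by (simp add: lookup_add sum.distrib lookup_single when_def)
    qed
    \<comment> \<open>Characteristic zero enters here: the factor \<open>Suc\<close> in
      \<open>lookup_partial\<close> is invertible, so a vanishing derivative removes every monomial
      containing \<open>v\<close>.\<close>
    then have z: "Poly_Mapping.lookup f (m + Poly_Mapping.single v 1) = 0" for m v
      using lookup_partial[of v f m] by (simp del: of_nat_Suc)
    have "f = Const (Poly_Mapping.lookup f 0)"
    proof (rule poly_mapping_eqI)
      fix m
      show "Poly_Mapping.lookup f m = Poly_Mapping.lookup (Const (Poly_Mapping.lookup f 0)) m"
      proof (cases "m = 0")
        case False
        then obtain v where "Poly_Mapping.lookup m v \<noteq> 0"
          by (metis lookup_zero poly_mapping_eqI)
        then have "m = (m - Poly_Mapping.single v 1) + Poly_Mapping.single v 1"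
          by (intro poly_mapping_eqI) (auto simp: lookup_add lookup_minus lookup_single when_def)
        then have "Poly_Mapping.lookup f m = 0"
          by (metis z)
        with False show ?thesis
          by (simp add: Const_def lookup_single when_def)
      qed (simp add: Const_def)
    qed
    then show ?case
      by (metis Const.h_0 const Suc.prems(1))
  qed
  have fin: "finite (?deg ` Poly_Mapping.keys f)" by simp
  show ?thesis
  proof (rule *[OF \<open>f \<in> I\<close>, of "Suc (Max (?deg ` Poly_Mapping.keys f))"])
    fix m assume "Poly_Mapping.lookup f m \<noteq> 0"
    then have "?deg m \<le> Max (?deg ` Poly_Mapping.keys f)"
      by (intro Max_ge fin) (auto simp: in_keys_iff)
    then show "?deg m < Suc (Max (?deg ` Poly_Mapping.keys f))" by simp
  qed
qed

section \<open>Determinants\<close>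

lemma det_replace_row:
  "det (\<chi> k l. if k = i then C k l else B k l) =
    (\<Sum>p | p permutes UNIV. of_int (sign p) * (C i (p i) * (\<Prod>k\<in>UNIV - {i}. B k (p k))))"
  unfolding det_def by (intro sum.cong refl) (simp add: prod.remove[of UNIV i])

lemma sum_det_replace_row:
  "(\<Sum>i\<in>UNIV. det (\<chi> k l. if k = i then C k l else B k l)) =
    (\<Sum>p | p permutes UNIV. of_int (sign p) * (\<Sum>i\<in>UNIV. C i (p i) * (\<Prod>k\<in>UNIV - {i}. B k (p k))))"
  unfolding det_replace_row by (subst sum.swap) (simp add: sum_distrib_left)

text \<open>Stated for an arbitrary derivation so that it applies to \<open>current_act Y m\<close>,
  which differentiates a determinant one row at a time.\<close>

lemma derivation_det:
  fixes B :: "'r::comm_ring_1^'n^'n"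
  assumes add: "\<And>f g. \<delta> (f + g) = \<delta> f + \<delta> g"
    and mult: "\<And>f g. \<delta> (f * g) = \<delta> f * g + f * \<delta> g"
  shows "\<delta> (det B) = (\<Sum>i\<in>UNIV. det (\<chi> k l. if k = i then \<delta> (B $ k $ l) else B $ k $ l))"
proof -
  have 0: "\<delta> 0 = 0" using add[of 0 0] by simp
  \<comment> \<open>The signs in the Leibniz expansion are integers, and a derivation kills these
    because it kills 1.\<close>
  have 1: "\<delta> 1 = 0" using mult[of 1 1] by simp
  have minus: "\<delta> (- f) = - \<delta> f" for f
    using add[of "- f" f] by (simp add: 0 eq_neg_iff_add_eq_0)
  have nat: "\<delta> (of_nat n) = 0" for n by (induction n) (simp_all add: 0 1 add)
  have int: "\<delta> (of_int n) = 0" for n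
    by (cases n) (simp_all add: nat minus 0 1 add del: of_nat_Suc)
  have sum: "\<delta> (sum F S) = (\<Sum>x\<in>S. \<delta> (F x))" for F :: "'c \<Rightarrow> 'r" and S
    by (induction S rule: infinite_finite_induct) (simp_all add: 0 add)
  have prod: "\<delta> (prod F S) = (\<Sum>i\<in>S. \<delta> (F i) * prod F (S - {i}))" if "finite S"
    for F :: "'n \<Rightarrow> 'r" and S
    using that
  proof (induction S rule: finite_induct)
    case (insert x S)
    have "(\<Sum>i\<in>S. \<delta> (F i) * prod F (insert x S - {i})) = (\<Sum>i\<in>S. F x * (\<delta> (F i) * prod F (S - {i})))"
    proof (rule sum.cong)
      fix i assume "i \<in> S"
      with insert.hyps have "insert x S - {i} = insert x (S - {i})" by auto
      with insert.hyps show "\<delta> (F i) * prod F (insert x S - {i}) = F x * (\<delta> (F i) * prod F (S - {i}))"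
        by (simp add: mult_ac)
    qed simp
    with insert show ?case by (simp add: mult sum_distrib_left)
  qed (simp add: 1)
  show ?thesis
    unfolding sum_det_replace_row det_def[of B]
    by (simp add: sum mult int prod)
qed

text \<open>In each product of the Leibniz expansion every factor is replaced once, whether the
  factors are indexed by their row or by their column; \<open>j = p i\<close> matches the two
  indexings.\<close>

lemma sum_det_replace_column:
  fixes B C :: "'n::finite \<Rightarrow> 'n \<Rightarrow> 'r::comm_ring_1"
  shows "(\<Sum>j\<in>UNIV. det (\<chi> k l. if l = j then C k l else B k l)) =
    (\<Sum>i\<in>UNIV. det (\<chi> k l. if k = i then C k l else B k l))"
proof -
  have "(\<Sum>j\<in>UNIV. det (\<chi> k l. if l = j then C k l else B k l)) =
    (\<Sum>p | p permutes UNIV. of_int (sign p) *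
      (\<Sum>j\<in>UNIV. \<Prod>k\<in>UNIV. if p k = j then C k (p k) else B k (p k)))"
    unfolding det_def by (subst sum.swap) (simp add: sum_distrib_left)
  also have "\<dots> = (\<Sum>p | p permutes UNIV. of_int (sign p) *
      (\<Sum>i\<in>UNIV. C i (p i) * (\<Prod>k\<in>UNIV - {i}. B k (p k))))"
  proof (rule sum.cong)
    fix p :: "'n \<Rightarrow> 'n" assume "p \<in> {p. p permutes UNIV}"
    then have p: "p permutes UNIV" by simp
    have inj: "p k = p i \<longleftrightarrow> k = i" for k i
      using permutes_inj[OF p] by (auto dest: injD)
    have "(\<Sum>j\<in>UNIV. \<Prod>k\<in>UNIV. if p k = j then C k (p k) else B k (p k)) =
      (\<Sum>i\<in>UNIV. \<Prod>k\<in>UNIV. if p k = p i then C k (p k) else B k (p k))"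
      by (subst sum.permute[OF p]) (simp add: o_def)
    also have "\<dots> = (\<Sum>i\<in>UNIV. C i (p i) * (\<Prod>k\<in>UNIV - {i}. B k (p k)))"
    proof (rule sum.cong)
      fix i
      show "(\<Prod>k\<in>UNIV. if p k = p i then C k (p k) else B k (p k)) =
        C i (p i) * (\<Prod>k\<in>UNIV - {i}. B k (p k))"
        by (simp add: inj prod.remove[of UNIV i])
    qed simp
    finally show "of_int (sign p) * (\<Sum>j\<in>UNIV. \<Prod>k\<in>UNIV. if p k = j then C k (p k) else B k (p k)) =
      of_int (sign p) * (\<Sum>i\<in>UNIV. C i (p i) * (\<Prod>k\<in>UNIV - {i}. B k (p k)))"
      by (rule arg_cong)
  qed simp
  finally show ?thesis by (simp add: sum_det_replace_row)
qed

text \<open>This is the derivative of det(B(1 + tY)) at t = 0. With columns in place of rows, column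
  \<open>j\<close> becomes a combination of columns of \<open>B\<close>; all but the multiple of
  column \<open>j\<close> itself produce a repeated column.\<close>

lemma sum_det_row_mult_eq_trace:
  fixes B Y :: "'r::comm_ring_1^'n^'n"
  shows "(\<Sum>i\<in>UNIV. det (\<chi> k l. if k = i then (B ** Y) $ k $ l else B $ k $ l)) = trace Y * det B"
proof -
  have "det (\<chi> k l. if l = j then (B ** Y) $ k $ l else B $ k $ l) = Y $ j $ j * det B" for j
  proof -
    have "det (\<chi> k l. if l = j then (B ** Y) $ k $ l else B $ k $ l) =
      det (\<chi> l. if l = j then (\<Sum>x\<in>UNIV. Y $ x $ j *s (transpose B $ x)) else transpose B $ l)"
      by (subst det_transpose[symmetric], rule arg_cong[where f=det])
        (simp add: vec_eq_iff transpose_def matrix_matrix_mult_def mult.commute)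
    also have "\<dots> = (\<Sum>x\<in>UNIV. Y $ x $ j * det (\<chi> l. if l = j then transpose B $ x else transpose B $ l))"
      by (subst det_linear_row_sum) (simp_all add: det_row_mul)
    also have "\<dots> = (\<Sum>x\<in>UNIV. if x = j then Y $ j $ j * det B else 0)"
    proof (rule sum.cong)
      fix x
      show "Y $ x $ j * det (\<chi> l. if l = j then transpose B $ x else transpose B $ l) =
        (if x = j then Y $ j $ j * det B else 0)"
      proof (cases "x = j")
        case True
        then have "(\<chi> l. if l = j then transpose B $ x else transpose B $ l) = transpose B"
          by (simp add: vec_eq_iff)
        with True show ?thesis by simp
      next
        case False
        have "det (\<chi> l. if l = j then transpose B $ x else transpose B $ l) = 0"
          by (rule det_identical_rows[OF False]) (simp add: row_def False)
        with False show ?thesis by simp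
      qed
    qed simp
    finally show ?thesis by simp
  qed
  then show ?thesis
    unfolding sum_det_replace_column[symmetric] trace_def by (simp add: sum_distrib_right)
qed

section \<open>Relative invariants\<close>

definition env :: "'r ^ 'm ^ 'm \<Rightarrow> 'r ^ 'm ^ 'p \<Rightarrow> ('m, 'p) var \<Rightarrow> 'r" where
  "env P Q v = (case v of XV i j \<Rightarrow> P $ i $ j | AV a i \<Rightarrow> Q $ a $ i)"

lemma env_simps [simp]: "env P Q (XV i j) = P $ i $ j" "env P Q (AV a i) = Q $ a $ i"
  by (simp_all add: env_def)

lemma eval_XA_eq: "eval_XA P Q = polyeval Const (env P Q)"
  by (simp add: eval_XA_def subst_eq_polyeval env_def[abs_def])

lemma Cmat_eq: "Cmat = mmap Const"
  by (simp add: Cmat_def mmap_def fun_eq_iff)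

lemma matrix_pow_add: "matrix_pow B (m + n) = matrix_pow B m ** matrix_pow B n"
  by (induction m) (simp_all add: matrix_pow_Suc matrix_mul_assoc)

lemma matrix_pow_conj:
  fixes P :: "'r::comm_ring_1^'m^'m"
  assumes "g ** g' = mat 1" "g' ** g = mat 1"
  shows "matrix_pow (g ** P ** g') n = g ** matrix_pow P n ** g'"
proof (induction n)
  case (Suc n)
  have "g ** P ** g' ** (g ** matrix_pow P n ** g') = g ** P ** (g' ** g) ** matrix_pow P n ** g'"
    by (simp add: matrix_mul_assoc)
  with Suc show ?case
    by (simp add: matrix_pow_Suc assms matrix_mul_assoc)
qed (simp add: assms)

context coefficient_hom
begin

lemma mmap_polyeval_Const: "mmap (polyeval h \<phi>) (mmap Const g) = mmap h g"
  by (simp add: vec_eq_iff)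

lemma mmap_env_XA:
  "mmap (polyeval h (env P Q)) Xmat = P" "mmap (polyeval h (env P Q)) Amat = Q"
  by (simp_all add: vec_eq_iff Xmat_def Amat_def)

lemma polyeval_env:
  "polyeval h \<psi> (polyeval Const (env P Q) f) =
    polyeval h (env (mmap (polyeval h \<psi>) P) (mmap (polyeval h \<psi>) Q)) f"
proof -
  have "(\<lambda>v. polyeval h \<psi> (env P Q v)) = env (mmap (polyeval h \<psi>) P) (mmap (polyeval h \<psi>) Q)"
    by (rule ext) (simp add: env_def split: var.split)
  then show ?thesis
    by (simp add: polyeval_subst)
qed

end

text \<open>Any one-sided inverse \<open>g'\<close> replaces \<open>matrix_inv g\<close>, so
  explicit inverses can be supplied without computing \<open>matrix_inv\<close>.\<close>

lemma HH_iff: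
  "f \<in> HH l \<longleftrightarrow> (\<forall>g g'. g ** g' = mat 1 \<longrightarrow>
     polyeval Const (env (Cmat g ** Xmat ** Cmat g') (Amat ** Cmat g')) f =
       Const (det g powi (- int l)) * f)" (is "_ \<longleftrightarrow> ?R")
proof
  assume f: "f \<in> HH l"
  show ?R
  proof (intro allI impI)
    fix g g' :: "complex^'a^'a" assume gg: "g ** g' = mat 1"
    then have gg': "g' ** g = mat 1" by (simp add: matrix_left_right_inverse)
    have "g ** matrix_inv g = mat 1 \<and> matrix_inv g ** g = mat 1"
      unfolding matrix_inv_def by (rule someI_ex) (use gg gg' in blast)
    then have "matrix_inv g = g'"
      by (metis gg matrix_mul_assoc matrix_mul_lid matrix_mul_rid)
    moreover have "invertible g" using gg gg' by (auto simp: invertible_def)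
    ultimately show "polyeval Const (env (Cmat g ** Xmat ** Cmat g') (Amat ** Cmat g')) f =
       Const (det g powi (- int l)) * f"
      using f by (auto simp: HH_def eval_XA_eq cscale_def)
  qed
next
  assume R: ?R
  show "f \<in> HH l"
    unfolding HH_def
  proof (intro CollectI allI impI)
    fix g :: "complex^'a^'a" assume "invertible g"
    then have "g ** matrix_inv g = mat 1 \<and> matrix_inv g ** g = mat 1"
      unfolding matrix_inv_def invertible_def by (rule someI_ex)
    with R show "eval_XA (Cmat g ** Xmat ** Cmat (matrix_inv g)) (Amat ** Cmat (matrix_inv g)) f =
      cscale (det g powi - int l) f"
      by (simp add: eval_XA_eq cscale_def)
  qed
qed

text \<open>The invariance is an identity between polynomials in the entries of X and A, hence it
  may be specialised to matrices over any commutative ring, both numerical and polynomial.\<close>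

lemma (in coefficient_hom) HH_polyeval:
  assumes "f \<in> HH l" "g ** g' = mat 1"
  shows "polyeval h (env (mmap h g ** P ** mmap h g') (Q ** mmap h g')) f =
    h (det g powi (- int l)) * polyeval h (env P Q) f"
proof -
  have "polyeval h (env P Q) (polyeval Const (env (Cmat g ** Xmat ** Cmat g') (Amat ** Cmat g')) f) =
    polyeval h (env P Q) (Const (det g powi (- int l)) * f)"
    using assms by (simp add: HH_iff)
  then show ?thesis
    by (simp add: polyeval_env polyeval_mult Cmat_eq pe.mmap_mult mmap_env_XA mmap_polyeval_Const)
qed

lemma subspace_HH: "mpoly.subspace (HH l)"
  by (auto simp: mpoly.subspace_def HH_iff Const.polyeval_add Const.polyeval_mult cscale_def
      distrib_left distrib_right mult_ac)

definition rowdet :: "('m \<Rightarrow> 'p) \<Rightarrow> ('m \<Rightarrow> nat) \<Rightarrow> ('m::finite, 'p::finite) xapoly" where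
  "rowdet r e = det (\<chi> i j. (Amat ** matrix_pow Xmat (e i)) $ r i $ j)"

lemma (in coefficient_hom) polyeval_rowdet:
  "polyeval h (env P Q) (rowdet r e) = det (\<chi> i j. (Q ** matrix_pow P (e i)) $ r i $ j)"
proof -
  have "polyeval h (env P Q) ((Amat ** matrix_pow Xmat n) $ a $ j) = (Q ** matrix_pow P n) $ a $ j"
    for n a j
    unfolding mmap_nth[of "polyeval h (env P Q)", symmetric]
    by (simp only: pe.mmap_mult pe.mmap_matrix_pow mmap_env_XA)
  then show ?thesis
    by (simp add: rowdet_def polyeval_det)
qed

text \<open>The inner factors \<open>?g' ** ?g\<close> cancel, so every row A X^e is multiplied on
  the right by \<open>?g'\<close>, and this one factor leaves the determinant as
  det(g)^(-1).\<close>

lemma rowdet_in_HH: "rowdet r e \<in> HH 1"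
  unfolding HH_iff
proof (intro allI impI)
  fix g g' :: "complex^'a^'a" assume gg: "g ** g' = mat 1"
  then have gg': "g' ** g = mat 1" by (simp add: matrix_left_right_inverse)
  let ?g = "Cmat g :: ('a, 'b) xapoly^'a^'a" and ?g' = "Cmat g' :: ('a, 'b) xapoly^'a^'a"
  have 1: "?g ** ?g' = mat 1" "?g' ** ?g = mat 1"
    by (simp_all add: Cmat_eq gg gg' Const.hh.mmap_mat_1 flip: Const.hh.mmap_mult)
  have det: "det g * det g' = 1" by (metis det_I det_mul gg)
  have "Amat ** ?g' ** (?g ** matrix_pow Xmat n ** ?g') = Amat ** matrix_pow Xmat n ** ?g'" for n
  proof -
    have "Amat ** ?g' ** (?g ** matrix_pow Xmat n ** ?g') = Amat ** (?g' ** ?g) ** matrix_pow Xmat n ** ?g'"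
      by (simp only: matrix_mul_assoc)
    then show ?thesis by (simp only: 1 matrix_mul_rid)
  qed
  then have "polyeval Const (env (?g ** Xmat ** ?g') (Amat ** ?g')) (rowdet r e) =
    det ((\<chi> i j. (Amat ** matrix_pow Xmat (e i)) $ r i $ j) ** ?g')"
    by (simp add: Const.polyeval_rowdet matrix_pow_conj[OF 1])
      (simp add: matrix_matrix_mult_def)
  also have "\<dots> = rowdet r e * det ?g'"
    by (simp add: det_mul rowdet_def)
  also have "det ?g' = Const (det g')"
    by (simp add: Cmat_eq Const.hh.F_det)
  also have "det g' = det g powi (- int 1)"
    using det by (simp add: power_int_minus inverse_unique)
  finally show "polyeval Const (env (?g ** Xmat ** ?g') (Amat ** ?g')) (rowdet r e) =
    Const (det g powi (- int 1)) * rowdet r e"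
    by (simp add: mult.commute)
qed

lemma rowdet_compose:
  assumes "\<pi> permutes UNIV"
  shows "rowdet (r \<circ> \<pi>) (e \<circ> \<pi>) = of_int (sign \<pi>) * rowdet r e"
  using det_permute_rows[OF assms, of "\<chi> i j. (Amat ** matrix_pow Xmat (e i)) $ r i $ j"]
  by (simp add: rowdet_def)

section \<open>The current algebra action\<close>

lemma current_act_add: "current_act Y m (f + g) = current_act Y m f + current_act Y m g"
  by (simp add: current_act_def cscale_def partial_add distrib_left sum.distrib)

lemma current_act_mult:
  "current_act Y m (f * g) = current_act Y m f * g + f * current_act Y m g"
  by (simp add: current_act_def cscale_def partial_mult distrib_left sum.distrib
      sum_distrib_left sum_distrib_right mult_ac)

lemma current_act_0 [simp]: "current_act Y m 0 = 0"
  by (simp add: current_act_def cscale_def)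

lemma current_act_sum: "current_act Y m (sum f S) = (\<Sum>x\<in>S. current_act Y m (f x))"
  by (induction S rule: infinite_finite_induct) (simp_all add: current_act_add)

lemma current_act_Const [simp]: "current_act Y m (Const c) = 0"
  by (simp add: current_act_def cscale_def)

lemma current_act_cscale: "current_act Y m (cscale c f) = cscale c (current_act Y m f)"
  by (simp add: cscale_def current_act_mult)

text \<open>The operator differentiates only in the entries of A, so X is constant for it.\<close>

lemma current_act_matrix_pow [simp]: "current_act Y m (matrix_pow Xmat l $ i $ j) = 0"
proof (induction l arbitrary: i j)
  case 0
  have "mat 1 $ i $ j = (Const (if i = j then 1 else 0) :: ('a, 'b) xapoly)"
    by (simp add: mat_def Const.h_0 Const.h_1)
  then show ?case by simp
next
  case (Suc l)
  have "current_act Y m (Xmat $ i $ k) = 0" for k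
    by (simp add: Xmat_def current_act_def cscale_def partial_Var)
  with Suc show ?case
    by (simp add: matrix_pow_Suc matrix_matrix_mult_def current_act_sum current_act_mult)
qed

lemma current_act_Amat:
  "current_act Y m (Amat $ b $ i) = (\<Sum>a\<in>UNIV. cscale (Y $ a $ b) ((Amat ** matrix_pow Xmat m) $ a $ i))"
proof -
  have d: "partial (AV c k) (Amat $ b $ i) = (if k = i then if c = b then 1 else 0 else 0)" for c k
    by (auto simp: Amat_def partial_Var)
  have "(\<Sum>x\<in>UNIV. \<Sum>k\<in>UNIV. Amat $ a $ x * matrix_pow Xmat m $ x $ k * partial (AV c k) (Amat $ b $ i)) =
    (if c = b then (Amat ** matrix_pow Xmat m) $ a $ i else 0)" for a c
    unfolding d by (auto simp: matrix_matrix_mult_def if_distrib[where f="(*) _"] cong: if_cong)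
  then show ?thesis
    unfolding current_act_def
    by (simp add: if_distrib[where f="cscale _"] mpoly.scale_zero_right cong: if_cong)
qed

lemma current_act_row:
  "current_act Y m ((Amat ** matrix_pow Xmat l) $ b $ j) =
    (\<Sum>a\<in>UNIV. cscale (Y $ a $ b) ((Amat ** matrix_pow Xmat (m + l)) $ a $ j))"
proof -
  have "current_act Y m ((Amat ** matrix_pow Xmat l) $ b $ j) =
    (\<Sum>i\<in>UNIV. \<Sum>a\<in>UNIV. cscale (Y $ a $ b) ((Amat ** matrix_pow Xmat m) $ a $ i) * matrix_pow Xmat l $ i $ j)"
    by (subst matrix_matrix_mult_def)
      (simp add: current_act_sum current_act_mult current_act_Amat sum_distrib_right)
  also have "\<dots> = (\<Sum>a\<in>UNIV. cscale (Y $ a $ b)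
      (\<Sum>i\<in>UNIV. (Amat ** matrix_pow Xmat m) $ a $ i * matrix_pow Xmat l $ i $ j))"
    by (subst sum.swap) (simp add: cscale_def sum_distrib_left mult.assoc)
  also have "\<dots> = (\<Sum>a\<in>UNIV. cscale (Y $ a $ b) ((Amat ** matrix_pow Xmat (m + l)) $ a $ j))"
    by (simp add: matrix_pow_add matrix_mul_assoc)
      (simp add: matrix_matrix_mult_def)
  finally show ?thesis .
qed

text \<open>By the Leibniz rule the rows are hit one at a time. The hit row gets a new index from
  \<open>Y\<close> and the extra factor X^m, which only raises its exponent, so the span of these
  determinants is stable.\<close>

lemma current_act_rowdet:
  "current_act Y m (rowdet r e) =
    (\<Sum>i\<in>UNIV. \<Sum>a\<in>UNIV. cscale (Y $ a $ r i) (rowdet (r(i := a)) (e(i := m + e i))))"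
proof -
  let ?R = "\<lambda>a n. (Amat ** matrix_pow Xmat n) $ a"
  have "current_act Y m (rowdet r e) = (\<Sum>i\<in>UNIV.
      det (\<chi> k j. if k = i then current_act Y m (?R (r k) (e k) $ j) else ?R (r k) (e k) $ j))"
    unfolding rowdet_def
    by (subst derivation_det[where \<delta>="current_act Y m"]) (simp_all add: current_act_add current_act_mult cong: if_cong)
  also have "\<dots> = (\<Sum>i\<in>UNIV.
      det (\<chi> k. if k = i then (\<Sum>a\<in>UNIV. Const (Y $ a $ r i) *s ?R a (m + e i)) else ?R (r k) (e k)))"
    by (intro sum.cong refl arg_cong[where f=det])
      (simp add: vec_eq_iff current_act_row cscale_def)
  also have "\<dots> = (\<Sum>i\<in>UNIV. \<Sum>a\<in>UNIV. Const (Y $ a $ r i) *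
      det (\<chi> k. if k = i then ?R a (m + e i) else ?R (r k) (e k)))"
    by (subst det_linear_row_sum) (simp_all add: det_row_mul)
  also have "\<dots> = (\<Sum>i\<in>UNIV. \<Sum>a\<in>UNIV. cscale (Y $ a $ r i) (rowdet (r(i := a)) (e(i := m + e i))))"
    unfolding cscale_def rowdet_def
    by (intro sum.cong refl arg_cong2[where f="(*)"] arg_cong[where f=det])
      (simp add: vec_eq_iff)
  finally show ?thesis .
qed

section \<open>Density of the diagonalizable matrices\<close>

instance var :: (finite, finite) finite
proof
  have "(UNIV :: ('a, 'b) var set) = range (\<lambda>(i, j). XV i j) \<union> range (\<lambda>(a, i). AV a i)"
    by (auto simp: image_iff) (metis var.exhaust)
  then show "finite (UNIV :: ('a, 'b) var set)"
    by (metis finite_UnI finite_imageI finite)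
qed

definition diag :: "('m \<Rightarrow> 'r) \<Rightarrow> 'r::zero ^ 'm ^ 'm" where
  "diag d = (\<chi> i j. if i = j then d i else 0)"

definition elem :: "'m \<Rightarrow> 'm \<Rightarrow> 'r \<Rightarrow> 'r::zero ^ 'm ^ 'm" where
  "elem a b c = (\<chi> i j. if i = a \<and> j = b then c else 0)"

lemma diag_mult: "(diag d ** X) $ i $ j = (d i * X $ i $ j :: 'r::comm_ring_1)"
  by (simp add: diag_def matrix_matrix_mult_def if_distrib[where f="\<lambda>x. x * _"] cong: if_cong)

lemma mult_diag: "(X ** diag d) $ i $ j = (X $ i $ j * d j :: 'r::comm_ring_1)"
  by (simp add: diag_def matrix_matrix_mult_def if_distrib[where f="\<lambda>x. _ * x"] cong: if_cong)

lemma elem_mult: "(elem a b c ** X) $ i $ j = (if i = a then c * X $ b $ j else 0 :: 'r::comm_ring_1)"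
  by (cases "i = a")
    (simp_all add: elem_def matrix_matrix_mult_def if_distrib[where f="\<lambda>x. x * _"] cong: if_cong)

lemma mult_elem: "(X ** elem a b c) $ i $ j = (if j = b then X $ i $ a * c else 0 :: 'r::comm_ring_1)"
  by (cases "j = b")
    (simp_all add: elem_def matrix_matrix_mult_def if_distrib[where f="\<lambda>x. _ * x"] cong: if_cong)

lemma mult_elem_mult:
  "(X ** elem a b c ** Y) $ i $ j = (X $ i $ a * c * Y $ b $ j :: 'r::comm_ring_1)"
  by (subst matrix_matrix_mult_def)
    (simp add: mult_elem if_distrib[where f="\<lambda>x. x * _"] cong: if_cong)

lemma matrix_add_rdistrib_ring: "(A + B) ** C = A ** C + B ** (C :: 'r::comm_ring_1^'n^'m)"
  by (simp add: vec_eq_iff matrix_matrix_mult_def distrib_right sum.distrib)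

text \<open>For \<open>a \<noteq> b\<close> the matrix unit squares to zero, which gives the
  inverse. Conjugation contributes c(d_b - d_a) at position (a, b), and \<open>c\<close> solves this
  for the prescribed value \<open>s\<close>.\<close>

lemma diag_add_elem:
  fixes d :: "'m::finite \<Rightarrow> complex" and s :: complex
  assumes "d a \<noteq> d b"
  defines "c \<equiv> s / (d b - d a)"
  shows "(mat 1 + elem a b c) ** (mat 1 + elem a b (- c)) = mat 1"
    and "(mat 1 + elem a b c) ** diag d ** (mat 1 + elem a b (- c)) = diag d + elem a b s"
proof -
  have ab: "a \<noteq> b" using assms by auto
  have c: "c * d b = s + c * d a"
    using assms by (simp add: c_def field_simps)
  show "(mat 1 + elem a b c) ** (mat 1 + elem a b (- c)) = mat 1"
    using ab by (auto simp: vec_eq_iff matrix_add_ldistrib matrix_add_rdistrib_ring elem_mult)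
      (auto simp: elem_def)
  show "(mat 1 + elem a b c) ** diag d ** (mat 1 + elem a b (- c)) = diag d + elem a b s"
    using ab c by (auto simp: vec_eq_iff matrix_add_ldistrib matrix_add_rdistrib_ring elem_mult mult_elem mult_diag)
      (auto simp: elem_def diag_def)
qed

lemma sum_env:
  "(\<Sum>v\<in>UNIV. env U 0 v * G v) =
    (\<Sum>i\<in>UNIV. \<Sum>j\<in>UNIV. U $ i $ j * G (XV i j) :: 'r::comm_ring_1)"
proof -
  let ?f = "\<lambda>(i, j). XV i j"
  have "env U 0 v * G v = 0" if "v \<notin> range ?f" for v
    using that by (cases v) auto
  then have "(\<Sum>v\<in>UNIV. env U 0 v * G v) = (\<Sum>v\<in>range ?f. env U 0 v * G v)"
    by (intro sum.mono_neutral_right) auto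
  also have "\<dots> = (\<Sum>(i, j)\<in>UNIV. U $ i $ j * G (XV i j))"
    by (subst sum.reindex) (auto simp: inj_on_def intro!: sum.cong)
  finally show ?thesis
    by (simp add: sum.cartesian_product)
qed

text \<open>Conjugation by $1 + cE_{ab}$ moves \<open>diag d\<close> along the line in direction $E_{ab}$, and a change of
  the entries of \<open>d\<close> gives the diagonal directions.  So the ideal of the diagonalizable matrices with
  simple spectrum is closed under all partial derivatives.\<close>

lemma polyeval_diagonalizable_eq_0:
  fixes f :: "('m::finite, 'p::finite) xapoly"
  assumes "\<And>(g :: complex^'m^'m) g' d Q. g ** g' = mat 1 \<Longrightarrow> inj d \<Longrightarrow>
    polyeval (\<lambda>c. c) (env (g ** diag d ** g') Q) f = 0"
  shows "f = 0"
proof -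
  let ?ev = "polyeval (\<lambda>c::complex. c)"
  define I where "I = {f :: ('m, 'p) xapoly. \<forall>(g :: complex^'m^'m) g' d Q. g ** g' = mat 1 \<longrightarrow> inj d \<longrightarrow>
    ?ev (env (g ** diag d ** g') Q) f = 0}"
  show ?thesis
  proof (rule partial_closed_eq_0)
    show "f \<in> I" unfolding I_def using assms by blast
    fix c assume c: "Const c \<in> I"
    \<comment> \<open>A constant is seen only if some point lies in the vanishing set, so one matrix
      with distinct diagonal entries has to be exhibited.\<close>
    have "inj (\<lambda>i::'m. of_nat (to_nat i) :: complex)"
      by (auto intro: injI)
    with c show "c = 0"
      unfolding I_def by (auto dest!: spec[of _ "mat 1"])
  next
    fix f v assume f: "f \<in> I"
    show "partial v f \<in> I"
      unfolding I_def
    proof (intro CollectI allI impI)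
      fix g g' :: "complex^'m^'m" and d :: "'m \<Rightarrow> complex" and Q :: "complex^'m^'p"
      assume g: "g ** g' = mat 1" and d: "inj d"
      define P where "P = g ** diag d ** g'"
      define G where "G v = ?ev (env P Q) (partial v f)" for v
      \<comment> \<open>If \<open>f\<close> vanishes along a line near the base point, the
        derivative in that direction is zero; this turns directions into linear equations for the
        gradient \<open>G\<close>.\<close>
      have chain: "(\<Sum>v\<in>UNIV. env U V v * G v) = 0"
        if ev: "\<forall>\<^sub>F s in nhds 0. ?ev (env (P + mmap ((*) s) U) (Q + mmap ((*) s) V)) f = 0" for U V
      proof -
        have "env P Q v + s * env U V v = env (P + mmap ((*) s) U) (Q + mmap ((*) s) V) v" for s v
          by (cases v) simp_all
        then have "((\<lambda>s. ?ev (env (P + mmap ((*) s) U) (Q + mmap ((*) s) V)) f) has_field_derivative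
            (\<Sum>v\<in>UNIV. env U V v * G v)) (at 0)"
          using has_field_derivative_polyeval_line[of "env P Q" "env U V" f] by (simp add: G_def)
        moreover have "((\<lambda>s. ?ev (env (P + mmap ((*) s) U) (Q + mmap ((*) s) V)) f) has_field_derivative 0) (at 0)"
          by (subst DERIV_cong_ev[OF refl ev refl]) simp
        ultimately show ?thesis by (rule DERIV_unique)
      qed
      have A: "G (AV a i) = 0" for a i
      proof -
        let ?V = "(\<chi> b j. if b = a \<and> j = i then 1 else 0) :: complex^'m^'p"
        have "P + mmap ((*) s) 0 = g ** diag d ** g'" for s
          by (simp add: P_def vec_eq_iff)
        then have "(\<Sum>v\<in>UNIV. env 0 ?V v * G v) = 0"
          using f g d by (intro chain always_eventually) (simp add: I_def)
        moreover have "env 0 ?V v = (if v = AV a i then 1 else 0)" for v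
          by (cases v) auto
        ultimately show ?thesis
          by (simp add: if_distrib[where f="\<lambda>x. x * _"] cong: if_cong)
      qed
      have E: "(\<Sum>i\<in>UNIV. \<Sum>j\<in>UNIV. (g ** elem a b 1 ** g') $ i $ j * G (XV i j)) = 0" for a b
      proof -
        let ?U = "g ** elem a b 1 ** g'"
        have U: "P + mmap ((*) s) ?U = g ** (diag d + elem a b s) ** g'" for s
        proof -
          have "mmap ((*) s) ?U = g ** elem a b s ** g'"
            by (simp add: vec_eq_iff mult_elem_mult)
          then show ?thesis
            by (simp add: P_def matrix_add_ldistrib matrix_add_rdistrib_ring)
        qed
        have "\<forall>\<^sub>F s in nhds 0. ?ev (env (g ** (diag d + elem a b s) ** g') (Q + mmap ((*) s) 0)) f = 0"
        \<comment> \<open>A diagonal direction keeps the entries distinct only while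
          \<open>s\<close> avoids finitely many nonzero values, hence the statement near 0. An
          off-diagonal direction does not change the spectrum and works for every
          \<open>s\<close>.\<close>
        proof (cases "a = b")
          case True
          have "\<forall>\<^sub>F s in nhds 0. s \<noteq> d j - d a" if "j \<noteq> a" for j
          proof (rule t1_space_nhds)
            show "0 \<noteq> d j - d a" using d that by (auto dest: injD)
          qed
          then have "\<forall>\<^sub>F s in nhds 0. \<forall>j\<in>- {a}. s \<noteq> d j - d a"
            by (intro eventually_ball_finite) auto
          then show ?thesis
          proof (rule eventually_mono)
            fix s assume s: "\<forall>j\<in>- {a}. s \<noteq> d j - d a"
            have "d a + s \<noteq> d j" if "j \<noteq> a" for j
              using s that by (auto simp: algebra_simps)
            then have "inj (d(a := d a + s))"
              using d unfolding inj_on_def by (metis fun_upd_apply)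
            moreover have "diag d + elem a b s = diag (d(a := d a + s))"
              by (auto simp: vec_eq_iff diag_def elem_def True)
            ultimately show "?ev (env (g ** (diag d + elem a b s) ** g') (Q + mmap ((*) s) 0)) f = 0"
              using f g by (simp add: I_def)
          qed
        next
          case False
          then have ne: "d a \<noteq> d b" using d by (auto dest: injD)
          show ?thesis
          proof (rule always_eventually, rule allI)
            fix s
            define c where "c = s / (d b - d a)"
            let ?k = "mat 1 + elem a b c" and ?k' = "mat 1 + elem a b (- c)"
            note k = diag_add_elem[OF ne, of s, folded c_def]
            have "g ** ?k ** (?k' ** g') = g ** (?k ** ?k') ** g'"
              by (simp only: matrix_mul_assoc)
            then have 1: "g ** ?k ** (?k' ** g') = mat 1"
              by (simp only: k g matrix_mul_rid)
            have 2: "g ** (diag d + elem a b s) ** g' = g ** ?k ** diag d ** (?k' ** g')"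
              unfolding k(2)[symmetric] by (simp only: matrix_mul_assoc)
            show "?ev (env (g ** (diag d + elem a b s) ** g') (Q + mmap ((*) s) 0)) f = 0"
              using f 1 d unfolding 2 I_def by blast
          qed
        qed
        then have "(\<Sum>v\<in>UNIV. env ?U 0 v * G v) = 0"
          by (intro chain) (simp only: U)
        then show ?thesis by (simp only: sum_env)
      qed
      \<comment> \<open>The relations \<open>E\<close> describe the gradient in the frame conjugated
        by \<open>g\<close>; together they say that a conjugate of the matrix \<open>M\<close> of
        X-derivatives is zero, and undoing the conjugation gives \<open>M = 0\<close>.\<close>
      define M where "M = (\<chi> i j. G (XV i j))"
      have "transpose g ** M ** transpose g' = 0"
      proof -
        have "(transpose g ** M ** transpose g') $ a $ b =
          (\<Sum>i\<in>UNIV. \<Sum>j\<in>UNIV. (g ** elem a b 1 ** g') $ i $ j * G (XV i j))" for a b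
          unfolding mult_elem_mult
          by (subst sum.swap)
            (simp add: matrix_matrix_mult_def transpose_def M_def sum_distrib_left mult_ac)
        with E show ?thesis by (simp add: vec_eq_iff)
      qed
      then have "transpose g' ** (transpose g ** M ** transpose g') ** transpose g = 0"
        by simp
      moreover have "transpose g' ** (transpose g ** M ** transpose g') ** transpose g =
        (transpose g' ** transpose g) ** M ** (transpose g' ** transpose g)"
        by (simp only: matrix_mul_assoc)
      ultimately have "M = 0"
        by (simp add: g flip: matrix_transpose_mul)
      then have "G (XV i j) = 0" for i j
        by (simp add: M_def vec_eq_iff)
      with A have "G v = 0" by (cases v) auto
      then show "?ev (env (g ** diag d ** g') Q) (partial v f) = 0"
        by (simp add: G_def P_def)
    qed
  qed
qed

section \<open>Restriction to diagonal matrices\<close>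

definition Xdiag :: "('m::finite, 'p::finite) xapoly ^ 'm ^ 'm" where
  "Xdiag = diag (\<lambda>i. Var (XV i i))"

definition diag_restrict :: "('m::finite, 'p::finite) xapoly \<Rightarrow> ('m, 'p) xapoly" where
  "diag_restrict = polyeval Const (env Xdiag Amat)"

text \<open>At a diagonalizable matrix the value of \<open>f\<close> is a multiple of a value at a
  diagonal matrix; with \<open>Q ** g\<close> in place of \<open>Q\<close> every second argument is
  reached.\<close>

lemma HH_diag_restrict_eq_0:
  assumes f: "f \<in> HH l" and 0: "diag_restrict f = 0"
  shows "f = 0"
proof (rule polyeval_diagonalizable_eq_0)
  fix g g' :: "complex^'a^'a" and d :: "'a \<Rightarrow> complex" and Q :: "complex^'a^'b"
  assume g: "g ** g' = mat 1"
  let ?ev = "polyeval (\<lambda>c::complex. c)"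
  have "?ev (env (diag d) Q') f = 0" for Q'
  proof -
    have "mmap (?ev (env (diag d) Q')) Xdiag = diag d"
      by (simp add: vec_eq_iff Xdiag_def diag_def)
    then have "?ev (env (diag d) Q') (diag_restrict f) = ?ev (env (diag d) Q') f"
      by (simp add: diag_restrict_def pt.polyeval_env pt.mmap_env_XA)
    with 0 show ?thesis by simp
  qed
  moreover have "mmap (\<lambda>c. c) B = B" for B :: "complex^'a^'a"
    by (simp add: vec_eq_iff)
  ultimately have "?ev (env (g ** diag d ** g') (Q ** g ** g')) f = 0"
    using pt.HH_polyeval[OF f g, of "diag d" "Q ** g"] by simp
  moreover have "Q ** g ** g' = Q"
    by (simp add: g flip: matrix_mul_assoc)
  ultimately show "?ev (env (g ** diag d ** g') Q) f = 0" by simp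
qed

lemma det_diag: "det (diag d) = (\<Prod>i\<in>UNIV. d i)"
  by (subst det_diagonal) (simp_all add: diag_def)

lemma two_power_inject:
  assumes "(2::complex) ^ m = 2 ^ n"
  shows "m = n"
proof -
  have "of_nat (2 ^ m) = (of_nat (2 ^ n) :: complex)" using assms by simp
  then have "(2::nat) ^ m = 2 ^ n" by (simp only: of_nat_eq_iff)
  then show ?thesis by simp
qed

text \<open>Diagonal matrices commute with \<open>Xdiag\<close>, so torus invariance concerns A
  alone and determines the degree in each of its columns.\<close>

lemma keys_diag_restrict:
  assumes f: "f \<in> HH 1" and m: "m \<in> Poly_Mapping.keys (diag_restrict f)"
  shows "(\<Sum>a\<in>UNIV. Poly_Mapping.lookup m (AV a i)) = 1"
    and "i \<noteq> j \<Longrightarrow> Poly_Mapping.lookup m (XV i j) = 0"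
proof -
  have mon: "monomial t m = (\<Prod>v\<in>UNIV. t v ^ Poly_Mapping.lookup m v)" for t :: "_ \<Rightarrow> complex"
    by (rule monomial_superset) auto
  \<comment> \<open>The coordinate \<open>i\<close> is scaled by 1/2: the character takes the value
    2, and column \<open>i\<close> of A is doubled. Comparison of powers of 2 yields degree one in
    that column.\<close>
  define t where "t j = (if j = i then 1/2 else 1 :: complex)" for j
  define t' where "t' j = (if j = i then 2 else 1 :: complex)" for j
  define \<tau> :: "('a, 'b) var \<Rightarrow> complex"
    where "\<tau> v = (case v of XV j k \<Rightarrow> 1 | AV a j \<Rightarrow> t' j)" for v
  let ?\<phi> = "polyeval Const (\<lambda>v. Const (\<tau> v) * Var v) :: ('a, 'b) xapoly \<Rightarrow> ('a, 'b) xapoly"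
  have "diag t ** diag t' = mat 1"
    by (simp add: vec_eq_iff diag_mult) (simp add: diag_def mat_def t_def t'_def)
  from Const.HH_polyeval[OF f this, of Xdiag Amat]
  have "polyeval Const (env (mmap Const (diag t) ** Xdiag ** mmap Const (diag t')) (Amat ** mmap Const (diag t'))) f
    = Const (det (diag t) powi (- 1)) * diag_restrict f"
    by (simp add: diag_restrict_def)
  also have "mmap Const (diag t) ** Xdiag ** mmap Const (diag t') = (Xdiag :: ('a, 'b) xapoly^'a^'a)"
  proof -
    have d: "mmap Const (diag s) = (diag (\<lambda>i. Const (s i)) :: ('a, 'b) xapoly^'a^'a)" for s
      by (simp add: vec_eq_iff diag_def Const.h_0)
    have "Const (t j) * Const (t' j) = (1 :: ('a, 'b) xapoly)" for j
      by (simp add: t_def t'_def Const.h_1 flip: Const.h_mult)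
    then show ?thesis
      unfolding d
      by (simp add: vec_eq_iff mult_diag diag_mult) (simp add: Xdiag_def diag_def mult_ac flip: mult.assoc)
  qed
  also have "polyeval Const (env Xdiag (Amat ** mmap Const (diag t'))) f = ?\<phi> (diag_restrict f)"
  proof -
    have d: "mmap Const (diag t') = (diag (\<lambda>i. Const (t' i)) :: ('a, 'b) xapoly^'a^'a)"
      by (simp add: vec_eq_iff diag_def Const.h_0)
    have "mmap ?\<phi> Amat = Amat ** mmap Const (diag t')"
      unfolding d by (simp add: vec_eq_iff mult_diag) (simp add: Amat_def \<tau>_def mult_ac)
    moreover have "mmap ?\<phi> Xdiag = Xdiag"
      by (simp add: vec_eq_iff Xdiag_def diag_def \<tau>_def Const.h_1)
    ultimately show ?thesis
      by (simp add: diag_restrict_def Const.polyeval_env)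
  qed
  also have "det (diag t) powi (- 1) = 2"
    by (simp add: det_diag t_def)
  finally have "?\<phi> (diag_restrict f) = cscale 2 (diag_restrict f)"
    by (simp only: cscale_def)
  from arg_cong[OF this, of "\<lambda>h. Poly_Mapping.lookup h m"]
  have "monomial \<tau> m * Poly_Mapping.lookup (diag_restrict f) m = 2 * Poly_Mapping.lookup (diag_restrict f) m"
    by (simp only: lookup_scale_vars lookup_cscale)
  then have "monomial \<tau> m = 2"
    using m by (simp add: in_keys_iff)
  moreover have "monomial \<tau> m = 2 ^ (\<Sum>a\<in>UNIV. Poly_Mapping.lookup m (AV a i))"
  proof -
    have "monomial \<tau> m = (\<Prod>v\<in>range (\<lambda>a. AV a i). \<tau> v ^ Poly_Mapping.lookup m v)"
      unfolding mon by (rule prod.mono_neutral_right) (auto simp: \<tau>_def t'_def split: var.split)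
    also have "\<dots> = (\<Prod>a\<in>UNIV. 2 ^ Poly_Mapping.lookup m (AV a i))"
      by (subst prod.reindex) (auto simp: inj_on_def \<tau>_def t'_def)
    finally show ?thesis by (simp add: power_sum)
  qed
  ultimately show "(\<Sum>a\<in>UNIV. Poly_Mapping.lookup m (AV a i)) = 1"
    using two_power_inject[of _ 1] by simp
  \<comment> \<open>This scaling sets the off-diagonal variables to 0 and therefore fixes
    \<open>diag_restrict f\<close>; since 0^0 = 1, a monomial survives exactly if it contains none
    of them.\<close>
  define \<sigma> :: "('a, 'b) var \<Rightarrow> complex"
    where "\<sigma> v = (case v of XV j k \<Rightarrow> if j = k then 1 else 0 | AV a j \<Rightarrow> 1)" for v
  let ?\<psi> = "polyeval Const (\<lambda>v. Const (\<sigma> v) * Var v) :: ('a, 'b) xapoly \<Rightarrow> ('a, 'b) xapoly"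
  have "mmap ?\<psi> Amat = Amat" "mmap ?\<psi> Xdiag = Xdiag"
    by (simp_all add: vec_eq_iff Xdiag_def Amat_def diag_def \<sigma>_def Const.h_1)
  then have "?\<psi> (diag_restrict f) = diag_restrict f"
    by (simp only: diag_restrict_def Const.polyeval_env)
  from arg_cong[OF this, of "\<lambda>h. Poly_Mapping.lookup h m"]
  have "monomial \<sigma> m * Poly_Mapping.lookup (diag_restrict f) m = Poly_Mapping.lookup (diag_restrict f) m"
    by (simp only: lookup_scale_vars)
  then have "monomial \<sigma> m = 1"
    using m by (simp add: in_keys_iff)
  then have "\<sigma> (XV i j) ^ Poly_Mapping.lookup m (XV i j) \<noteq> 0"
    using prod_zero[OF finite, of UNIV "\<lambda>v. \<sigma> v ^ Poly_Mapping.lookup m v"]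
    unfolding mon by (metis UNIV_I zero_neq_one)
  then show "i \<noteq> j \<Longrightarrow> Poly_Mapping.lookup m (XV i j) = 0"
    by (simp add: \<sigma>_def)
qed

definition rename :: "('m \<Rightarrow> 'm) \<Rightarrow> ('m::finite, 'p::finite) xapoly \<Rightarrow> ('m, 'p) xapoly" where
  "rename \<pi> = polyeval Const (env (\<chi> i j. Var (XV (\<pi> i) (\<pi> j))) (\<chi> a i. Var (AV a (\<pi> i))))"

text \<open>Permutation matrices normalise the diagonal matrices, so invariance under them survives
  the restriction. The character is the sign, which is its own inverse.\<close>

lemma rename_diag_restrict:
  assumes f: "f \<in> HH 1" and p: "\<pi> permutes UNIV"
  shows "rename \<pi> (diag_restrict f) = of_int (sign \<pi>) * diag_restrict f"
proof -
  have inj: "\<pi> i = \<pi> j \<longleftrightarrow> i = j" for i j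
    using permutes_inj[OF p] by (auto dest: injD)
  define g :: "complex^'a^'a" where "g = (\<chi> i j. if \<pi> i = j then 1 else 0)"
  define g' :: "complex^'a^'a" where "g' = (\<chi> i j. if i = \<pi> j then 1 else 0)"
  have gg: "g ** g' = mat 1"
    by (simp add: vec_eq_iff matrix_matrix_mult_def g_def g'_def mat_def inj
        if_distrib[where f="\<lambda>x. x * _"] cong: if_cong)
  have g: "g = (\<chi> i. mat 1 $ \<pi> i)"
    by (simp add: vec_eq_iff g_def mat_def)
  have "det g = of_int (sign \<pi>)"
    unfolding g by (simp add: det_permute_rows[OF p])
  then have "det g powi (- 1) = of_int (sign \<pi>)"
    by (cases "\<pi>" rule: sign_cases) simp_all
  moreover have "Const (of_int (sign \<pi>)) = (of_int (sign \<pi>) :: ('a, 'b) xapoly)"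
    by (rule Const.hh.F_of_int)
  moreover have "mmap Const g ** Xdiag ** mmap Const g' = mmap (rename \<pi>) (Xdiag :: ('a, 'b) xapoly^'a^'a)"
    by (simp add: vec_eq_iff matrix_matrix_mult_def g_def g'_def Xdiag_def diag_def
        if_distrib[where f="\<lambda>x. x * _"] if_distrib[where f="\<lambda>x. _ * x"] if_distrib[where f=Const] Const.h_0 Const.h_1
        rename_def if_distrib[where f="polyeval _ _"] inj cong: if_cong)
  moreover have "Amat ** mmap Const g' = mmap (rename \<pi>) (Amat :: ('a, 'b) xapoly^'a^'b)"
    by (simp add: vec_eq_iff matrix_matrix_mult_def g'_def Amat_def
        if_distrib[where f="\<lambda>x. _ * x"] if_distrib[where f=Const] Const.h_0 Const.h_1 rename_def cong: if_cong)
  ultimately show ?thesis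
    using Const.HH_polyeval[OF f gg, of Xdiag Amat]
    by (simp add: diag_restrict_def rename_def Const.polyeval_env)
qed

lemma matrix_pow_diag: "matrix_pow (diag d) n = diag (\<lambda>i. d i ^ n :: 'r::comm_ring_1)"
proof (induction n)
  case 0
  show ?case by (simp add: vec_eq_iff mat_def diag_def)
next
  case (Suc n)
  then show ?case by (simp add: matrix_pow_Suc vec_eq_iff diag_mult) (simp add: diag_def)
qed

text \<open>The term of the identity permutation in the Leibniz expansion of the restricted
  determinant; the whole determinant is its antisymmetrisation.\<close>

definition diag_monomial :: "('m \<Rightarrow> 'p) \<Rightarrow> ('m \<Rightarrow> nat) \<Rightarrow> ('m::finite, 'p::finite) xapoly" where
  "diag_monomial r e = (\<Prod>i\<in>UNIV. Var (AV (r i) i) * Var (XV i i) ^ e i)"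

lemma diag_restrict_rowdet:
  "diag_restrict (rowdet r e) = (\<Sum>\<pi> | \<pi> permutes UNIV. of_int (sign \<pi>) * rename \<pi> (diag_monomial r e))"
proof -
  have "diag_restrict (rowdet r e) = det (\<chi> i j. Var (AV (r i) j) * Var (XV j j) ^ e i)"
    by (simp add: diag_restrict_def Const.polyeval_rowdet Xdiag_def matrix_pow_diag mult_diag Amat_def)
  then show ?thesis
    by (simp add: det_def diag_monomial_def rename_def Const.pe.F_prod Const.polyeval_mult Const.pe.F_power)
qed

text \<open>Degree one in column \<open>i\<close> of A singles out one row \<open>r i\<close>, and
  without off-diagonal variables only the exponents of the diagonal entries remain.\<close>

lemma single_eq_diag_monomial:
  fixes m :: "('m::finite, 'p::finite) var \<Rightarrow>\<^sub>0 nat"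
  assumes A: "\<And>i. (\<Sum>a\<in>UNIV. Poly_Mapping.lookup m (AV a i)) = 1"
    and X: "\<And>i j. i \<noteq> j \<Longrightarrow> Poly_Mapping.lookup m (XV i j) = 0"
  shows "\<exists>r e. \<forall>c. Poly_Mapping.single m c = cscale c (diag_monomial r e)"
proof -
  have "\<exists>a. \<forall>b. Poly_Mapping.lookup m (AV b i) = (if b = a then 1 else 0)" for i
    using A[of i] unfolding sum_eq_1_iff[OF finite] by (metis UNIV_I)
  then obtain r where r: "Poly_Mapping.lookup m (AV b i) = (if b = r i then 1 else 0)" for b i
    by metis
  define e where "e i = Poly_Mapping.lookup m (XV i i)" for i
  have "m = (\<Sum>i\<in>UNIV. Poly_Mapping.single (AV (r i) i) 1 + Poly_Mapping.single (XV i i) (e i))"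
  proof (rule poly_mapping_eqI)
    fix v
    show "Poly_Mapping.lookup m v = Poly_Mapping.lookup
      (\<Sum>i\<in>UNIV. Poly_Mapping.single (AV (r i) i) 1 + Poly_Mapping.single (XV i i) (e i)) v"
    proof (cases v)
      case (XV i j)
      then show ?thesis
        by (cases "i = j") (simp_all add: lookup_sum lookup_add lookup_single when_def e_def X sum.neutral)
    next
      case (AV b i)
      then have "(AV (r x) x = v) = (x = i \<and> r i = b)" for x by auto
      with AV show ?thesis
        by (cases "r i = b") (auto simp: lookup_sum lookup_add lookup_single when_def r)
    qed
  qed
  then have "monomial Var m = (diag_monomial r e :: ('m, 'p) xapoly)"
    by (simp add: diag_monomial_def monomial_sum monomial_add del: One_nat_def)
  then show ?thesis
    by (auto simp: single_eq_monomial cscale_def)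
qed

text \<open>The restriction of \<open>f\<close> is alternating, so it is its own antisymmetrisation
  up to a factorial, and each antisymmetrised monomial is a restricted determinant. Injectivity of
  the restriction on invariants lifts the resulting equality.\<close>

theorem HH_1_subset_span_rowdet:
  "HH 1 \<subseteq> mpoly.span {rowdet r e :: ('m::finite, 'p::finite) xapoly | r e. True}" (is "_ \<subseteq> mpoly.span ?D")
proof
  fix f :: "('m, 'p) xapoly" assume f: "f \<in> HH 1"
  let ?K = "Poly_Mapping.keys (diag_restrict f)"
  let ?c = "Poly_Mapping.lookup (diag_restrict f)"
  have "\<exists>r e. \<forall>c. Poly_Mapping.single m c = cscale c (diag_monomial r e)" if "m \<in> ?K" for m
    by (rule single_eq_diag_monomial) (use keys_diag_restrict[OF f that] in auto)
  then obtain r e where re: "Poly_Mapping.single m c = cscale c (diag_monomial (r m) (e m))" if "m \<in> ?K" for m c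
    by metis
  define D where "D m = rowdet (r m) (e m)" for m
  let ?N = "of_nat (fact CARD('m)) :: complex"
  \<comment> \<open>The division by \<open>?N\<close>, the order of the symmetric group, undoes the
    summation over all permutations below.\<close>
  define g where "g = (\<Sum>m\<in>?K. cscale (?c m / ?N) (D m))"
  have span: "D m \<in> mpoly.span ?D" for m
    unfolding D_def by (rule mpoly.span_base) auto
  then have g_span: "g \<in> mpoly.span ?D"
    unfolding g_def by (intro mpoly.span_sum mpoly.span_scale)
  have "mpoly.span ?D \<subseteq> HH 1"
    by (rule mpoly.span_minimal[OF _ subspace_HH]) (auto simp: rowdet_in_HH[simplified])
  with g_span have g: "g \<in> HH 1" by auto
  have "?N \<noteq> 0" by simp
  \<comment> \<open>In the sum over all permutations each copy of \<open>diag_restrict f\<close> is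
    rewritten by the alternating property; the two signs cancel.\<close>
  have "cscale ?N (diag_restrict f) = (\<Sum>\<pi>::'m\<Rightarrow>'m | \<pi> permutes UNIV. diag_restrict f)"
  proof -
    have "Const ?N = (of_nat (fact CARD('m)) :: ('m, 'p) xapoly)"
      by (metis Const.hh.F_of_int of_int_of_nat_eq)
    then show ?thesis
      by (simp add: card_permutations cscale_def)
  qed
  also have "\<dots> = (\<Sum>\<pi> | \<pi> permutes UNIV. of_int (sign \<pi>) * rename \<pi> (diag_restrict f))"
  proof (intro sum.cong refl)
    fix \<pi> :: "'m \<Rightarrow> 'm" assume "\<pi> \<in> {\<pi>. \<pi> permutes UNIV}"
    then have p: "\<pi> permutes UNIV" by simp
    show "diag_restrict f = of_int (sign \<pi>) * rename \<pi> (diag_restrict f)"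
      unfolding rename_diag_restrict[OF f p]
      by (cases "\<pi>" rule: sign_cases) simp_all
  qed
  also have "\<dots> = (\<Sum>\<pi> | \<pi> permutes UNIV. \<Sum>m\<in>?K.
      cscale (?c m) (of_int (sign \<pi>) * rename \<pi> (diag_monomial (r m) (e m))))"
  proof (intro sum.cong refl)
    fix \<pi> :: "'m \<Rightarrow> 'm"
    have "diag_restrict f = (\<Sum>m\<in>?K. cscale (?c m) (diag_monomial (r m) (e m)))"
      by (subst poly_mapping_eq_sum_single) (intro sum.cong refl re)
    from arg_cong[OF this, of "rename \<pi>"]
    have "rename \<pi> (diag_restrict f) = (\<Sum>m\<in>?K. cscale (?c m) (rename \<pi> (diag_monomial (r m) (e m))))"
      by (simp add: rename_def Const.polyeval_sum Const.polyeval_mult cscale_def)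
    then show "of_int (sign \<pi>) * rename \<pi> (diag_restrict f) = (\<Sum>m\<in>?K.
      cscale (?c m) (of_int (sign \<pi>) * rename \<pi> (diag_monomial (r m) (e m))))"
      by (simp add: sum_distrib_left cscale_def mult_ac)
  qed
  also have "\<dots> = (\<Sum>m\<in>?K. cscale (?c m) (diag_restrict (D m)))"
    by (subst sum.swap) (simp add: D_def diag_restrict_rowdet sum_distrib_left cscale_def)
  also have "\<dots> = cscale ?N (diag_restrict g)"
  proof -
    have "diag_restrict (cscale c h) = cscale c (diag_restrict h)" for c and h :: "('m, 'p) xapoly"
      by (simp add: diag_restrict_def Const.polyeval_mult cscale_def)
    moreover have "diag_restrict g = (\<Sum>m\<in>?K. diag_restrict (cscale (?c m / ?N) (D m)))"
      unfolding g_def by (simp only: diag_restrict_def Const.polyeval_sum)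
    ultimately show ?thesis
      by (simp add: mpoly.scale_sum_right)
  qed
  finally have "diag_restrict f = diag_restrict g"
    using \<open>?N \<noteq> 0\<close> by (metis mpoly.scale_left_imp_eq)
  then have "diag_restrict (f - g) = 0"
    by (simp add: diag_restrict_def Const.pe.F_diff)
  moreover have "f - g \<in> HH 1"
    using f g by (rule mpoly.subspace_diff[OF subspace_HH])
  ultimately have "f - g = 0" by (rule HH_diag_restrict_eq_0[rotated])
  with g_span show "f \<in> mpoly.span ?D" by simp
qed

section \<open>Relations between coinvariants\<close>

text \<open>The factor 1_n leaves the label \<open>fst (r i)\<close> alone, so \<open>y\<close> acts
  on colours only.\<close>

lemma current_act_kronecker_rowdet:
  fixes y :: "complex^'k::finite^'k" and r :: "'k \<Rightarrow> 'n::finite \<times> 'k"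
  shows "current_act (kronecker (mat 1) y) m (rowdet r e) =
    (\<Sum>i\<in>UNIV. \<Sum>c\<in>UNIV. cscale (y $ c $ snd (r i)) (rowdet (r(i := (fst (r i), c))) (e(i := m + e i))))"
proof -
  have "(\<Sum>a\<in>UNIV. cscale (kronecker (mat 1) y $ a $ r i) (F a)) =
    (\<Sum>c\<in>UNIV. cscale (y $ c $ snd (r i)) (F (fst (r i), c)))"
    for i and F :: "'n \<times> 'k \<Rightarrow> ('k, 'n \<times> 'k) xapoly"
  proof -
    have "(\<Sum>a\<in>UNIV. cscale (kronecker (mat 1) y $ a $ r i) (F a)) =
      (\<Sum>a\<in>UNIV. \<Sum>c\<in>UNIV. cscale (kronecker (mat 1) y $ (a, c) $ r i) (F (a, c)))"
      by (simp add: sum.cartesian_product)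
    also have "\<dots> = (\<Sum>a\<in>UNIV. if a = fst (r i) then
        (\<Sum>c\<in>UNIV. cscale (y $ c $ snd (r i)) (F (fst (r i), c))) else 0)"
      by (intro sum.cong refl) (auto simp: kronecker_def mat_def)
    finally show ?thesis by simp
  qed
  then show ?thesis by (simp add: current_act_rowdet)
qed

lemma slk_HH_generator:
  "trace y = 0 \<Longrightarrow> f \<in> HH 1 \<Longrightarrow> current_act (kronecker (mat 1) y) m f \<in> slk_HH"
  unfolding slk_HH_def by (rule mpoly.span_base) auto

lemma zero_in_slk_HH [simp]: "0 \<in> slk_HH"
  by (simp add: slk_HH_def mpoly.span_zero)

lemma trace_diag: "trace (diag d) = (\<Sum>i\<in>UNIV. d i)"
  by (simp add: trace_def diag_def)

text \<open>For a missing colour \<open>p\<close> and an occurring colour \<open>q\<close> the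
  traceless matrix E_pp - E_qq has the determinant as an eigenvector. The eigenvalue is minus the
  multiplicity of \<open>q\<close>, which is nonzero, so the determinant itself lies in the
  image.\<close>

lemma rowdet_in_slk_HH:
  fixes r :: "'k::finite \<Rightarrow> 'n::finite \<times> 'k"
  assumes "\<not> surj (snd \<circ> r)"
  shows "rowdet r e \<in> slk_HH"
proof -
  obtain p where p: "\<And>i. snd (r i) \<noteq> p" using assms unfolding surj_def by (metis comp_apply)
  \<comment> \<open>Rows are indexed by the colour type, so the row with index \<open>p\<close>
    exists; its colour occurs by construction and differs from \<open>p\<close>.\<close>
  define q where "q = snd (r p)"
  have pq: "p \<noteq> q" using p[of p] by (simp add: q_def)
  define y :: "complex^'k^'k" where "y = diag (\<lambda>c. if c = p then 1 else if c = q then -1 else 0)"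
  have "(\<Sum>c\<in>UNIV. if c = p then 1 else if c = q then -1 else 0 :: complex) =
    (\<Sum>c\<in>UNIV. (if c = p then 1 else 0) - (if c = q then 1 else 0))"
    using pq by (intro sum.cong) auto
  then have "trace y = 0"
    by (simp add: y_def trace_diag sum_subtractf)
  then have "current_act (kronecker (mat 1) y) 0 (rowdet r e) \<in> slk_HH"
    by (rule slk_HH_generator[OF _ rowdet_in_HH])
  also have "current_act (kronecker (mat 1) y) 0 (rowdet r e) =
    (\<Sum>i\<in>UNIV. if snd (r i) = q then cscale (-1) (rowdet r e) else 0)"
  proof -
    have "(\<Sum>c\<in>UNIV. cscale (y $ c $ snd (r i)) (rowdet (r(i := (fst (r i), c))) (e(i := 0 + e i)))) =
      (\<Sum>c\<in>UNIV. if c = snd (r i) then if snd (r i) = q then cscale (-1) (rowdet r e) else 0 else 0)" for i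
    proof (intro sum.cong refl)
      fix c
      show "cscale (y $ c $ snd (r i)) (rowdet (r(i := (fst (r i), c))) (e(i := 0 + e i))) =
        (if c = snd (r i) then if snd (r i) = q then cscale (-1) (rowdet r e) else 0 else 0)"
        using p[of i] by (cases "c = snd (r i)") (auto simp: y_def diag_def)
    qed
    then show ?thesis by (simp add: current_act_kronecker_rowdet)
  qed
  also have "\<dots> = cscale (- of_nat (card {i. snd (r i) = q})) (rowdet r e)" (is "_ = cscale ?N _")
  proof -
    have "(\<Sum>i\<in>UNIV. if snd (r i) = q then cscale (-1) (rowdet r e) else 0) =
      cscale (\<Sum>i\<in>UNIV. if snd (r i) = q then -1 else 0) (rowdet r e)"
      unfolding mpoly.scale_sum_left by (intro sum.cong refl) simp
    then show ?thesis by (simp add: sum.If_cases)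
  qed
  finally have "cscale (1 / ?N) (cscale ?N (rowdet r e)) \<in> slk_HH"
    unfolding slk_HH_def by (rule mpoly.span_scale)
  moreover have "?N \<noteq> 0"
    by (auto simp: q_def)
  ultimately show ?thesis by (simp del: of_nat_eq_0_iff card_eq_0_iff)
qed

section \<open>Determinants sorted by colour and the congruences between them\<close>

definition color_det :: "('k \<Rightarrow> 'n) \<Rightarrow> ('k \<Rightarrow> nat) \<Rightarrow> ('k::finite, 'n::finite \<times> 'k) xapoly" where
  "color_det u e = rowdet (\<lambda>i. (u i, i)) e"

text \<open>There are as many rows as colours, so a surjective colouring is a permutation, and
  sorting by it costs a sign.\<close>

lemma rowdet_eq_color_det:
  fixes r :: "'k::finite \<Rightarrow> 'n::finite \<times> 'k"
  assumes "surj (snd \<circ> r)"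
  shows "\<exists>n u e'. rowdet r e = cscale (of_int n) (color_det u e')"
proof -
  let ?c = "snd \<circ> r"
  have c: "?c permutes UNIV"
    using assms by (intro bij_imp_permutes) (simp_all add: bij_def finite_UNIV_surj_inj)
  have "rowdet r e = rowdet ((\<lambda>i. (fst (r (inv ?c i)), i)) \<circ> ?c) ((e \<circ> inv ?c) \<circ> ?c)"
    using permutes_inverses[OF c] by (simp add: o_def)
  also have "\<dots> = cscale (of_int (sign ?c)) (color_det (\<lambda>i. fst (r (inv ?c i))) (e \<circ> inv ?c))"
    unfolding color_det_def rowdet_compose[OF c] cscale_def by (simp add: Const.hh.F_of_int)
  finally show ?thesis by blast
qed

text \<open>The basic relation. If colour \<open>q\<close> occurs twice and \<open>p\<close> not at
  all, E_pq with z^s recolours either occurrence to \<open>p\<close> and raises the exponent of that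
  row by \<open>s\<close>. The two results have the colours \<open>p\<close> and \<open>q\<close> in
  opposite order, so sorting one of them gives the minus sign of the congruence.\<close>

lemma color_det_shift:
  fixes u :: "'k::finite \<Rightarrow> 'n::finite" and p q :: 'k
  defines "\<tau> \<equiv> Transposition.transpose p q"
  shows "color_det u (e(p := s + e p)) - color_det (u \<circ> \<tau>) ((e \<circ> \<tau>)(p := s + e q)) \<in> slk_HH"
proof (cases "p = q")
  case True
  then show ?thesis by (simp add: \<tau>_def)
next
  case False
  \<comment> \<open>The sorted family with row \<open>p\<close> recoloured to \<open>q\<close>:
    recolouring it back gives the first determinant, recolouring row \<open>q\<close> gives the
    second.\<close>
  define r where "r = (\<lambda>i. (u i, i))(p := (u p, q))"
  have "trace (elem p q 1) = (0 :: complex)"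
    using False by (auto simp: trace_def elem_def intro!: sum.neutral)
  then have "current_act (kronecker (mat 1) (elem p q 1)) s (rowdet r e) \<in> slk_HH"
    by (rule slk_HH_generator[OF _ rowdet_in_HH])
  also have "current_act (kronecker (mat 1) (elem p q 1)) s (rowdet r e) =
    (\<Sum>i\<in>UNIV. if snd (r i) = q then rowdet (r(i := (fst (r i), p))) (e(i := s + e i)) else 0)"
  proof -
    have "(\<Sum>c\<in>UNIV. cscale (elem p q 1 $ c $ snd (r i)) (rowdet (r(i := (fst (r i), c))) (e(i := s + e i)))) =
      (\<Sum>c\<in>UNIV. if c = p then if snd (r i) = q then rowdet (r(i := (fst (r i), p))) (e(i := s + e i)) else 0 else 0)" for i
      by (intro sum.cong refl) (auto simp: elem_def)
    then show ?thesis by (simp add: current_act_kronecker_rowdet)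
  qed
  also have "\<dots> = (\<Sum>i\<in>{p, q}. rowdet (r(i := (fst (r i), p))) (e(i := s + e i)))"
    by (rule sum.mono_neutral_cong_right) (auto simp: r_def)
  also have "\<dots> = color_det u (e(p := s + e p)) + rowdet (r(q := (u q, p))) (e(q := s + e q))"
  proof -
    have "r(p := (u p, p)) = (\<lambda>i. (u i, i))" by (auto simp: r_def)
    with False show ?thesis by (simp add: color_det_def) (simp add: r_def)
  qed
  \<comment> \<open>Composition with the transposition puts colours \<open>p\<close> and
    \<open>q\<close> back in order; labels and exponents travel with their rows.\<close>
  also have "rowdet (r(q := (u q, p))) (e(q := s + e q)) =
    rowdet ((\<lambda>i. ((u \<circ> \<tau>) i, i)) \<circ> \<tau>) (((e \<circ> \<tau>)(p := s + e q)) \<circ> \<tau>)"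
    using False by (intro arg_cong2[where f=rowdet] ext) (auto simp: r_def \<tau>_def Transposition.transpose_def)
  also have "\<dots> = - color_det (u \<circ> \<tau>) ((e \<circ> \<tau>)(p := s + e q))"
  proof -
    have "\<tau> permutes UNIV" by (simp add: \<tau>_def permutes_swap_id)
    from rowdet_compose[OF this] show ?thesis
      using False by (simp add: color_det_def \<tau>_def sign_swap_id)
  qed
  finally show ?thesis by (simp only: diff_conv_add_uminus)
qed

abbreviation slk_cong :: "('k::finite, 'n::finite \<times> 'k) xapoly \<Rightarrow> ('k, 'n \<times> 'k) xapoly \<Rightarrow> bool" (infix "\<doteq>" 50)
  where "f \<doteq> g \<equiv> f - g \<in> slk_HH"

lemma slk_cong_sym: "f \<doteq> g \<Longrightarrow> g \<doteq> f"
  unfolding slk_HH_def by (drule mpoly.span_neg) simp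

lemma slk_cong_trans [trans]: "f \<doteq> g \<Longrightarrow> g \<doteq> h \<Longrightarrow> f \<doteq> h"
  unfolding slk_HH_def by (drule (1) mpoly.span_add) simp

lemma color_det_swap:
  "color_det u e \<doteq> color_det (u \<circ> Transposition.transpose p q) (e \<circ> Transposition.transpose p q)"
  using color_det_shift[of u e p 0 q] by (simp add: fun_upd_idem)

text \<open>The shift moves a power of X but also exchanges labels; the case \<open>s = 0\<close> of
  the shift exchanges them back.\<close>

lemma color_det_move: "color_det u (e(p := s + e p)) \<doteq> color_det u (e(q := s + e q))"
proof -
  let ?\<tau> = "Transposition.transpose p q"
  let ?e = "(e \<circ> ?\<tau>)(p := s + e q)"
  have "color_det u (e(p := s + e p)) \<doteq> color_det (u \<circ> ?\<tau>) ?e"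
    by (rule color_det_shift)
  also have "color_det (u \<circ> ?\<tau>) ?e \<doteq> color_det (u \<circ> ?\<tau> \<circ> ?\<tau>) (?e \<circ> ?\<tau>)"
    by (rule color_det_swap)
  also have "u \<circ> ?\<tau> \<circ> ?\<tau> = u" by (simp add: o_assoc[symmetric])
  also have "?e \<circ> ?\<tau> = e(q := s + e q)"
    by (auto simp: fun_eq_iff Transposition.transpose_def)
  finally show ?thesis .
qed

lemma color_det_concentrate:
  "color_det u e \<doteq> color_det u (\<lambda>i. if i = i0 then sum e UNIV else 0)"
proof -
  have "color_det u e \<doteq> color_det u (\<lambda>i. if i = i0 then e i0 + sum e S else if i \<in> S then 0 else e i)"
    if "finite S" "i0 \<notin> S" for S
    using that
  proof (induction S rule: finite_induct)
    case empty
    have "(\<lambda>i. if i = i0 then e i0 else e i) = e" by auto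
    then show ?case by (simp cong: if_cong)
  next
    case (insert x S)
    let ?e = "\<lambda>S i. if i = i0 then e i0 + sum e S else if i \<in> S then 0 else e i"
    let ?e' = "(?e S)(x := 0)"
    have "color_det u e \<doteq> color_det u (?e S)" using insert by simp
    \<comment> \<open>As \<open>?e'\<close> is 0 at \<open>x\<close>, the current exponents have the
      form in which the amount \<open>e x\<close> can be moved from \<open>x\<close> to
      \<open>i0\<close>.\<close>
    also have "?e S = ?e'(x := e x + ?e' x)" using insert by auto
    also have "color_det u \<dots> \<doteq> color_det u (?e'(i0 := e x + ?e' i0))"
      by (rule color_det_move)
    also have "?e'(i0 := e x + ?e' i0) = ?e (insert x S)"
      using insert by (auto simp: fun_eq_iff)
    finally show ?case .
  qed
  from this[of "- {i0}"] have *: "color_det u e \<doteq>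
      color_det u (\<lambda>i. if i = i0 then e i0 + sum e (- {i0}) else if i \<in> - {i0} then 0 else e i)"
    by simp
  have "sum e UNIV = e i0 + sum e (- {i0})"
    by (simp add: sum.remove[of UNIV i0] Compl_eq_Diff_UNIV)
  then have "(\<lambda>i. if i = i0 then e i0 + sum e (- {i0}) else if i \<in> - {i0} then 0 else e i) =
      (\<lambda>i. if i = i0 then sum e UNIV else 0)"
    by auto
  with * show ?thesis by simp
qed

lemma color_det_sum_cong:
  assumes "sum e UNIV = sum e' UNIV"
  shows "color_det u e \<doteq> color_det u e'"
  \<comment> \<open>Both exponent functions are concentrated on one common row; which one is
    immaterial, and \<open>undefined\<close> names it.\<close>
  using slk_cong_trans[OF color_det_concentrate slk_cong_sym[OF color_det_concentrate[of u e' undefined, folded assms]]] .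

text \<open>Transpositions generate the symmetric group. Each also permutes the exponents, but these
  matter only through their sum.\<close>

lemma color_det_permute:
  assumes "\<pi> permutes UNIV"
  shows "color_det (u \<circ> \<pi>) e \<doteq> color_det u e"
  using assms finite
proof (induction \<pi> arbitrary: u rule: permutes_induct)
  case id
  then show ?case by simp
next
  case (swap a b p)
  let ?\<tau> = "Transposition.transpose a b"
  have "color_det (u \<circ> (?\<tau> \<circ> p)) e \<doteq> color_det (u \<circ> ?\<tau>) e"
    using swap.IH[of "u \<circ> ?\<tau>"] by (simp only: o_assoc)
  also have "color_det (u \<circ> ?\<tau>) e \<doteq> color_det (u \<circ> ?\<tau> \<circ> ?\<tau>) (e \<circ> ?\<tau>)"
    by (rule color_det_swap)
  also have "u \<circ> ?\<tau> \<circ> ?\<tau> = u" by (simp add: o_assoc[symmetric])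
  also have "color_det u (e \<circ> ?\<tau>) \<doteq> color_det u e"
  proof (rule color_det_sum_cong)
    have "?\<tau> permutes UNIV" by (simp add: permutes_swap_id)
    then show "sum (e \<circ> ?\<tau>) UNIV = sum e UNIV" by (metis sum.permute)
  qed
  finally show ?case .
qed

text \<open>The exponent of x^s times the product of the a_(u i). It forgets exactly what the
  congruences forget: the order of the labels and the distribution of the exponents.\<close>

definition count_key :: "('k::finite \<Rightarrow> 'n) \<Rightarrow> nat \<Rightarrow> (1, 'n) var \<Rightarrow>\<^sub>0 nat" where
  "count_key u s = (\<Sum>i\<in>UNIV. Poly_Mapping.single (AV (u i) 1) 1) + Poly_Mapping.single (XV 1 1) s"

lemma lookup_count_key:
  "Poly_Mapping.lookup (count_key u s) (AV a 1) = card {i. u i = a}"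
  "Poly_Mapping.lookup (count_key u s) (XV 1 1) = s"
  by (simp_all add: count_key_def lookup_add lookup_sum lookup_single when_def sum.If_cases)

lemma color_det_cong:
  assumes "count_key u (sum e UNIV) = count_key u' (sum e' UNIV)"
  shows "color_det u e \<doteq> color_det u' e'"
proof -
  have card: "card {i. u i = a} = card {i. u' i = a}" for a
    using arg_cong[OF assms, of "\<lambda>m. Poly_Mapping.lookup m (AV a 1)"] by (simp add: lookup_count_key)
  have "image_mset u (mset_set UNIV) = image_mset u' (mset_set UNIV)"
    using card by (intro multiset_eqI) (simp add: count_image_mset vimage_def Int_def)
  from image_mset_eq_implies_permutes[OF finite this]
  obtain \<pi> where \<pi>: "\<pi> permutes UNIV" "\<forall>i\<in>UNIV. u i = u' (\<pi> i)" by blast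
  then have "u = u' \<circ> \<pi>" by auto
  then have "color_det u e \<doteq> color_det u' e"
    using color_det_permute[OF \<pi>(1)] by simp
  also have "color_det u' e \<doteq> color_det u' e'"
    using arg_cong[OF assms, of "\<lambda>m. Poly_Mapping.lookup m (XV 1 1)"]
    by (intro color_det_sum_cong) (simp add: lookup_count_key)
  finally show ?thesis .
qed

section \<open>The level-rank map\<close>

definition Acolor :: "(1, 'n::finite) xapoly ^ 'k::finite ^ ('n \<times> 'k)" where
  "Acolor = (\<chi> r j. if snd r = j then Var (AV (fst r) 1) else 0)"

lemma level_rank_eq:
  "level_rank = (polyeval Const (env (diag (\<lambda>_. Var (XV 1 1))) Acolor) ::
    ('k::finite, 'n::finite \<times> 'k) xapoly \<Rightarrow> (1, 'n) xapoly)"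
proof -
  have "(\<chi> r j. kronecker Amat (mat 1 :: (1, 'n) xapoly^'k^'k) $ r $ (1, j)) = Acolor"
    by (simp add: vec_eq_iff kronecker_def Amat_def Acolor_def mat_def)
  moreover have "mat x = diag (\<lambda>_::'k. x)" for x :: "(1, 'n) xapoly"
    by (simp add: vec_eq_iff mat_def diag_def)
  ultimately show ?thesis by (simp add: level_rank_def eval_XA_eq)
qed

lemma level_rank_add: "level_rank (f + g) = level_rank f + level_rank g"
  and level_rank_diff: "level_rank (f - g) = level_rank f - level_rank g"
  and level_rank_sum: "level_rank (sum F S) = (\<Sum>x\<in>S. level_rank (F x))"
  and level_rank_cscale: "level_rank (cscale c f) = cscale c (level_rank f)"
  and level_rank_0: "level_rank 0 = 0"
  by (simp_all add: level_rank_eq Const.polyeval_add Const.pe.F_diff Const.polyeval_sum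
      Const.polyeval_mult cscale_def)

lemma level_rank_rowdet:
  "level_rank (rowdet r e) = det (\<chi> i j. Var (XV 1 1) ^ e i * Acolor $ r i $ j)"
  by (simp add: level_rank_eq Const.polyeval_rowdet matrix_pow_diag mult_diag mult.commute)

text \<open>At X = x 1_k the factor z^m becomes the scalar x^m, and the action of \<open>y\<close>
  on the rows of A tensor 1_k equals right multiplication by the transpose of \<open>y\<close>. The
  determinant is thus multiplied by the trace of \<open>y\<close>; spanning reduces the claim to
  determinants.\<close>

lemma level_rank_current_act:
  fixes f :: "('k::finite, 'n::finite \<times> 'k) xapoly"
  assumes y: "trace y = 0" and f: "f \<in> HH 1"
  shows "level_rank (current_act (kronecker (mat 1) y) m f) = 0"
proof -
  have rowdet: "level_rank (current_act (kronecker (mat 1) y) m (rowdet r e)) = 0"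
    for r :: "'k \<Rightarrow> 'n \<times> 'k" and e
  proof -
    let ?x = "Var (XV 1 1) :: (1, 'n) xapoly"
    define B :: "(1, 'n) xapoly^'k^'k" where "B = (\<chi> i j. ?x ^ e i * Acolor $ r i $ j)"
    \<comment> \<open>The transpose, because an action on row indices of A tensor 1_k is rewritten
      as one on column indices.\<close>
    define Y :: "(1, 'n) xapoly^'k^'k" where "Y = (\<chi> i j. Const (y $ j $ i))"
    define a :: "'k \<Rightarrow> 'k \<Rightarrow> (1, 'n) xapoly^'k" where "a i c = (\<chi> j. ?x ^ e i * Acolor $ (fst (r i), c) $ j)" for i c
    have row: "level_rank (rowdet (r(i := (fst (r i), c))) (e(i := m + e i))) =
      ?x ^ m * det (\<chi> k. if k = i then a k c else B $ k)" for i c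
      unfolding level_rank_rowdet det_row_mul[symmetric]
      by (intro arg_cong[where f=det]) (simp add: vec_eq_iff B_def a_def power_add mult_ac)
    have sum: "(\<Sum>c\<in>UNIV. Const (y $ c $ snd (r i)) *s a i c) = (B ** Y) $ i" for i
    proof -
      have "(\<Sum>c\<in>UNIV. Const (y $ c $ snd (r i)) * a i c $ j) = ?x ^ e i * Var (AV (fst (r i)) 1) * Y $ snd (r i) $ j" for j
        by (simp add: a_def Acolor_def Y_def if_distrib[where f="(*) _"] mult_ac cong: if_cong)
      moreover have "(B ** Y) $ i $ j = ?x ^ e i * Var (AV (fst (r i)) 1) * Y $ snd (r i) $ j" for j
        by (simp add: matrix_matrix_mult_def B_def Acolor_def if_distrib[where f="(*) _"]
            if_distrib[where f="\<lambda>x. x * _"] cong: if_cong)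
      ultimately show ?thesis by (simp add: vec_eq_iff)
    qed
    have "level_rank (current_act (kronecker (mat 1) y) m (rowdet r e)) =
      (\<Sum>i\<in>UNIV. \<Sum>c\<in>UNIV. Const (y $ c $ snd (r i)) * (?x ^ m * det (\<chi> k. if k = i then a k c else B $ k)))"
      by (simp add: current_act_kronecker_rowdet level_rank_sum level_rank_cscale row) (simp add: cscale_def)
    also have "\<dots> = ?x ^ m * (\<Sum>i\<in>UNIV. \<Sum>c\<in>UNIV. det (\<chi> k. if k = i then Const (y $ c $ snd (r k)) *s a k c else B $ k))"
      unfolding sum_distrib_left
    proof (intro sum.cong refl)
      fix i c
      have "det (\<chi> k. if k = i then Const (y $ c $ snd (r k)) *s a k c else B $ k) =
        det (\<chi> k. if k = i then Const (y $ c $ snd (r i)) *s a k c else B $ k)"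
        by (intro arg_cong[where f=det]) (simp add: vec_eq_iff)
      then show "Const (y $ c $ snd (r i)) * (?x ^ m * det (\<chi> k. if k = i then a k c else B $ k)) =
        ?x ^ m * det (\<chi> k. if k = i then Const (y $ c $ snd (r k)) *s a k c else B $ k)"
        by (simp add: det_row_mul mult_ac)
    qed
    also have "\<dots> = ?x ^ m * (\<Sum>i\<in>UNIV. det (\<chi> k. if k = i then (B ** Y) $ k else B $ k))"
      unfolding sum[symmetric] by (simp add: det_linear_row_sum)
    also have "(\<Sum>i\<in>UNIV. det (\<chi> k. if k = i then (B ** Y) $ k else B $ k)) =
      (\<Sum>i\<in>UNIV. det (\<chi> k l. if k = i then (B ** Y) $ k $ l else B $ k $ l))"
      by (intro sum.cong refl arg_cong[where f=det]) (simp add: vec_eq_iff)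
    also have "\<dots> = trace Y * det B"
      by (rule sum_det_row_mult_eq_trace)
    also have "trace Y = Const (trace y)"
      by (simp add: trace_def Y_def Const.hh.F_sum)
    finally show ?thesis by (simp add: y Const.h_0)
  qed
  have "f \<in> mpoly.span {rowdet r e | r e. True}"
    using f HH_1_subset_span_rowdet by blast
  then show ?thesis
  proof (induction rule: mpoly.span_induct)
    case base
    show ?case
      by (auto simp: mpoly.subspace_def current_act_add level_rank_add current_act_cscale level_rank_cscale level_rank_0)
  next
    case (step f)
    then show ?case by (auto simp: rowdet)
  qed
qed

lemma level_rank_slk_HH:
  assumes "f \<in> slk_HH"
  shows "level_rank f = 0"
  using assms unfolding slk_HH_def
proof (induction rule: mpoly.span_induct)
  case base
  show ?case
    by (auto simp: mpoly.subspace_def level_rank_add level_rank_cscale level_rank_0)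
next
  case (step f)
  then show ?case by (auto simp: level_rank_current_act)
qed

text \<open>With colours sorted, the specialised matrix is diagonal, so only the identity
  permutation contributes, with sign one.\<close>

lemma level_rank_color_det:
  "level_rank (color_det u e) = Poly_Mapping.single (count_key u (sum e UNIV)) 1"
proof -
  have "level_rank (color_det u e) = det (\<chi> i. (Var (AV (u i) 1) * Var (XV 1 1) ^ e i) *s (mat 1 $ i))"
    unfolding color_det_def level_rank_rowdet
    by (intro arg_cong[where f=det]) (simp add: vec_eq_iff Acolor_def mat_def)
  also have "\<dots> = (\<Prod>i\<in>UNIV. Var (AV (u i) 1) * Var (XV 1 1) ^ e i)"
    unfolding det_rows_mul by simp
  also have "\<dots> = monomial Var (count_key u (sum e UNIV))"
    by (simp add: count_key_def monomial_add monomial_sum prod.distrib power_sum del: One_nat_def)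
  finally show ?thesis by (simp add: single_eq_monomial Const.h_1)
qed

text \<open>The scalar t in GL_1 acts on the target as t 1_k acts on the source, and the determinant
  of t 1_k is t^k; this turns the exponent 1 into \<open>CARD('k)\<close>.\<close>

lemma level_rank_in_HH:
  fixes f :: "('k::finite, 'n::finite \<times> 'k) xapoly"
  assumes f: "f \<in> HH 1"
  shows "level_rank f \<in> HH CARD('k)"
  unfolding HH_iff
proof (intro allI impI)
  fix g g' :: "complex^1^1" assume gg: "g ** g' = mat 1"
  let ?t = "g $ 1 $ 1" and ?t' = "g' $ 1 $ 1"
  have t: "?t * ?t' = 1"
    using gg by (simp add: vec_eq_iff matrix_matrix_mult_def mat_def)
  let ?g = "diag (\<lambda>_::'k. ?t)" and ?g' = "diag (\<lambda>_::'k. ?t')"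
  let ?D = "diag (\<lambda>_::'k. Var (XV 1 1) :: (1, 'n) xapoly)"
  let ?\<phi> = "polyeval Const (env (Cmat g ** Xmat ** Cmat g') (Amat ** Cmat g')) :: (1, 'n) xapoly \<Rightarrow> _"
  have d: "mmap Const (diag s) = (diag (\<lambda>i. Const (s i)) :: (1, 'n) xapoly^'k^'k)" for s
    by (simp add: vec_eq_iff diag_def Const.h_0)
  have tC: "Const ?t * Const ?t' = (1 :: (1, 'n) xapoly)"
    by (simp add: t Const.h_1 flip: Const.h_mult)
  have "?g ** ?g' = mat 1"
    by (simp add: vec_eq_iff diag_mult) (simp add: diag_def mat_def t)
  from Const.HH_polyeval[OF f this, of ?D Acolor]
  have "polyeval Const (env (mmap Const ?g ** ?D ** mmap Const ?g') (Acolor ** mmap Const ?g')) f =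
    Const (det ?g powi (- 1)) * level_rank f"
    by (simp add: level_rank_eq)
  also have "mmap Const ?g ** ?D ** mmap Const ?g' = mmap ?\<phi> ?D"
  proof -
    have "?\<phi> (Var (XV 1 1)) = Const ?t * Var (XV 1 1) * Const ?t'"
      by (simp add: matrix_matrix_mult_def Cmat_eq Xmat_def)
    then show ?thesis
      unfolding d by (simp add: vec_eq_iff mult_diag diag_mult) (simp add: diag_def)
  qed
  also have "Acolor ** mmap Const ?g' = mmap ?\<phi> (Acolor :: (1, 'n) xapoly^'k^('n \<times> 'k))"
    unfolding d
    by (simp add: vec_eq_iff mult_diag) (simp add: Acolor_def matrix_matrix_mult_def Cmat_eq Amat_def)
  also have "det ?g powi (- 1) = det g powi (- int CARD('k))"
    by (simp add: det_diag det_1 power_int_minus)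
  finally show "?\<phi> (level_rank f) = Const (det g powi (- int CARD('k))) * level_rank f"
    by (simp add: level_rank_eq Const.polyeval_env)
qed

section \<open>Monomials of the target and surjectivity\<close>

lemma ex_card_fibres:
  fixes N :: "'n::finite \<Rightarrow> nat"
  assumes "(\<Sum>a\<in>UNIV. N a) = CARD('k::finite)"
  shows "\<exists>u :: 'k \<Rightarrow> 'n. \<forall>a. card {i. u i = a} = N a"
proof -
  let ?S = "SIGMA a:UNIV. {..<N a}"
  have "card ?S = CARD('k)" using assms by simp
  then obtain b where b: "bij_betw b (UNIV :: 'k set) ?S"
    by (metis finite finite_SigmaI finite_lessThan finite_same_card_bij)
  have "card {i. fst (b i) = a} = N a" for a
  proof -
    have "b ` {i. fst (b i) = a} = {a} \<times> {..<N a}"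
    proof
      show "b ` {i. fst (b i) = a} \<subseteq> {a} \<times> {..<N a}"
      proof
        fix x assume "x \<in> b ` {i. fst (b i) = a}"
        then obtain i where "x = b i" "fst x = a" by auto
        moreover have "b i \<in> ?S" using bij_betwE[OF b] by blast
        ultimately show "x \<in> {a} \<times> {..<N a}" by (cases x) auto
      qed
      show "{a} \<times> {..<N a} \<subseteq> b ` {i. fst (b i) = a}"
      proof
        fix x assume x: "x \<in> {a} \<times> {..<N a}"
        then have "x \<in> ?S" by auto
        then obtain i where "x = b i" using b by (auto simp: bij_betw_def)
        with x show "x \<in> b ` {i. fst (b i) = a}" by auto
      qed
    qed
    moreover have "inj_on b {i. fst (b i) = a}"
      using b by (auto simp: bij_betw_def inj_on_def)
    ultimately show ?thesis
      by (metis card_image card_cartesian_product_singleton card_lessThan)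
  qed
  then show ?thesis by (intro exI[of _ "fst \<circ> b"]) simp
qed

lemma var_1_cases:
  fixes v :: "(1, 'n) var"
  obtains "v = XV 1 1" | a where "v = AV a 1"
  by (cases v) (metis num1_eq1)+

text \<open>For size one, conjugation is trivial and the invariance is homogeneity of degree k in A.
  A monomial of that degree is a multiset of k labels together with a power of x.\<close>

lemma keys_HH_1_eq_count_key:
  fixes f :: "(1, 'n::finite) xapoly"
  assumes f: "f \<in> HH CARD('k::finite)" and m: "m \<in> Poly_Mapping.keys f"
  shows "\<exists>(u :: 'k \<Rightarrow> 'n) (e :: 'k \<Rightarrow> nat). m = count_key u (sum e UNIV)"
proof -
  define \<tau> :: "(1, 'n) var \<Rightarrow> complex" where "\<tau> v = (case v of XV i j \<Rightarrow> 1 | AV a i \<Rightarrow> 2)" for v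
  let ?g = "diag (\<lambda>_. 1/2) :: complex^1^1" and ?g' = "diag (\<lambda>_. 2) :: complex^1^1"
  have half: "Const 2 * (Const (1/2) * x) = (x :: (1, 'n) xapoly)" for x
    by (simp add: Const.h_1 flip: Const.h_mult mult.assoc)
  have "?g ** ?g' = mat 1"
    by (simp add: vec_eq_iff diag_mult) (simp add: diag_def mat_def)
  with f have "polyeval Const (env (Cmat ?g ** Xmat ** Cmat ?g') (Amat ** Cmat ?g')) f =
    Const (det ?g powi (- int CARD('k))) * f"
    unfolding HH_iff by blast
  also have "env (Cmat ?g ** Xmat ** Cmat ?g') (Amat ** Cmat ?g') = (\<lambda>v. Const (\<tau> v) * Var v)"
  proof
    fix v :: "(1, 'n) var"
    show "env (Cmat ?g ** Xmat ** Cmat ?g') (Amat ** Cmat ?g') v = Const (\<tau> v) * Var v"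
      by (cases v rule: var_1_cases)
        (simp_all add: matrix_matrix_mult_def Cmat_eq Xmat_def Amat_def diag_def \<tau>_def half
          Const.h_1 mult.commute[of _ "Const 2"] del: num1_eq1)
  qed
  also have "det ?g powi (- int CARD('k)) = 2 ^ CARD('k)"
    by (simp add: det_diag power_int_minus power_one_over)
  finally have eq: "polyeval Const (\<lambda>v. Const (\<tau> v) * Var v) f = cscale (2 ^ CARD('k)) f"
    by (simp only: cscale_def)
  from arg_cong[OF this, of "\<lambda>h. Poly_Mapping.lookup h m"]
  have "monomial \<tau> m * Poly_Mapping.lookup f m = 2 ^ CARD('k) * Poly_Mapping.lookup f m"
    by (simp only: lookup_scale_vars lookup_cscale)
  then have "monomial \<tau> m = 2 ^ CARD('k)"
    using m by (simp add: in_keys_iff)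
  moreover have "monomial \<tau> m = 2 ^ (\<Sum>a\<in>UNIV. Poly_Mapping.lookup m (AV a 1))"
  proof -
    have "monomial \<tau> m = (\<Prod>v\<in>UNIV. \<tau> v ^ Poly_Mapping.lookup m v)"
      by (rule monomial_superset) auto
    also have "\<dots> = (\<Prod>v\<in>range (\<lambda>a. AV a 1). \<tau> v ^ Poly_Mapping.lookup m v)"
      by (rule prod.mono_neutral_right) (auto simp: \<tau>_def split: var.split)
    also have "\<dots> = (\<Prod>a\<in>UNIV. 2 ^ Poly_Mapping.lookup m (AV a 1))"
      by (subst prod.reindex) (auto simp: inj_on_def \<tau>_def)
    finally show ?thesis by (simp add: power_sum)
  qed
  ultimately have "(\<Sum>a\<in>UNIV. Poly_Mapping.lookup m (AV a 1)) = CARD('k)"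
    using two_power_inject by metis
  from ex_card_fibres[OF this] obtain u :: "'k \<Rightarrow> 'n"
    where u: "card {i. u i = a} = Poly_Mapping.lookup m (AV a 1)" for a by blast
  let ?s = "Poly_Mapping.lookup m (XV 1 1)"
  have m_eq: "m = count_key u ?s"
  proof (rule poly_mapping_eqI)
    fix v
    show "Poly_Mapping.lookup m v = Poly_Mapping.lookup (count_key u ?s) v"
      by (cases v rule: var_1_cases) (simp_all add: lookup_count_key u)
  qed
  \<comment> \<open>Only the total exponent is prescribed, so all of it is put on one arbitrary
    row.\<close>
  have sum: "sum (\<lambda>i. if i = undefined then ?s else 0) (UNIV :: 'k set) = ?s" by simp
  have "m = count_key u (sum (\<lambda>i. if i = undefined then ?s else 0) (UNIV :: 'k set))"
    by (subst sum) (rule m_eq)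
  then show ?thesis by blast
qed

lemma HH_1_subset_level_rank:
  "HH CARD('k) \<subseteq> level_rank ` (HH 1 :: ('k::finite, 'n::finite \<times> 'k) xapoly set)" (is "_ \<subseteq> _ ` ?H")
proof
  fix f :: "(1, 'n) xapoly" assume f: "f \<in> HH CARD('k)"
  obtain u :: "_ \<Rightarrow> 'k \<Rightarrow> 'n" and e :: "_ \<Rightarrow> 'k \<Rightarrow> nat"
    where ue: "m \<in> Poly_Mapping.keys f \<Longrightarrow> m = count_key (u m) (sum (e m) UNIV)" for m
    using keys_HH_1_eq_count_key[OF f] by metis
  let ?h = "\<Sum>m\<in>Poly_Mapping.keys f. cscale (Poly_Mapping.lookup f m) (color_det (u m) (e m))"
  have "level_rank ?h = (\<Sum>m\<in>Poly_Mapping.keys f. Poly_Mapping.single m (Poly_Mapping.lookup f m))"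
    unfolding level_rank_sum
  proof (rule sum.cong)
    fix m assume "m \<in> Poly_Mapping.keys f"
    from ue[OF this, symmetric]
    show "level_rank (cscale (Poly_Mapping.lookup f m) (color_det (u m) (e m))) =
      Poly_Mapping.single m (Poly_Mapping.lookup f m)"
      by (simp add: level_rank_cscale level_rank_color_det) (simp add: cscale_def Const_def mult_single)
  qed simp
  then have "f = level_rank ?h"
    by (simp flip: poly_mapping_eq_sum_single)
  moreover have "?h \<in> HH 1"
    unfolding color_det_def
    by (intro mpoly.subspace_sum[OF subspace_HH] mpoly.subspace_scale[OF subspace_HH] rowdet_in_HH)
  ultimately show "f \<in> level_rank ` ?H" by (rule image_eqI)
qed

section \<open>A linear inverse modulo the image of sl_k[z], and injectivity\<close>

definition key_rep :: "((1, 'n) var \<Rightarrow>\<^sub>0 nat) \<Rightarrow> ('k::finite, 'n::finite \<times> 'k) xapoly" where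
  "key_rep m = (SOME h. \<exists>u e. h = color_det u e \<and> m = count_key u (sum e UNIV))"

text \<open>Defined on all polynomials so that linearity needs no side condition; the arbitrary
  values of \<open>key_rep\<close> at monomials that are not keys do no harm, since
  \<open>level_rank\<close> of an invariant has no such monomials.\<close>

definition level_rank_section :: "(1, 'n) xapoly \<Rightarrow> ('k::finite, 'n::finite \<times> 'k) xapoly" where
  "level_rank_section f = (\<Sum>m\<in>Poly_Mapping.keys f. cscale (Poly_Mapping.lookup f m) (key_rep m))"

lemma level_rank_section_superset:
  assumes "finite S" "Poly_Mapping.keys f \<subseteq> S"
  shows "level_rank_section f = (\<Sum>m\<in>S. cscale (Poly_Mapping.lookup f m) (key_rep m))"
  unfolding level_rank_section_def
  by (rule sum.mono_neutral_left) (use assms in \<open>auto simp: in_keys_iff\<close>)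

lemma level_rank_section_add:
  "level_rank_section (f + g) = level_rank_section f + level_rank_section g"
proof -
  let ?S = "Poly_Mapping.keys f \<union> Poly_Mapping.keys g"
  have "Poly_Mapping.keys (f + g) \<subseteq> ?S" by (rule keys_add)
  then show ?thesis
    by (simp add: level_rank_section_superset[of ?S] lookup_add mpoly.scale_left_distrib sum.distrib)
qed

lemma level_rank_section_cscale:
  "level_rank_section (cscale c f) = cscale c (level_rank_section f)"
proof -
  have "Poly_Mapping.keys (cscale c f) \<subseteq> Poly_Mapping.keys f"
    by (auto simp: in_keys_iff)
  then show ?thesis
    by (simp add: level_rank_section_superset[of "Poly_Mapping.keys f"] mpoly.scale_sum_right)
qed

text \<open>The property is linear in \<open>f\<close>, so determinants suffice. With a colour
  missing, both sides are zero modulo \<open>slk_HH\<close>; otherwise the chosen representative has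
  the same key and is congruent by \<open>color_det_cong\<close>.\<close>

lemma level_rank_section_cong:
  fixes f :: "('k::finite, 'n::finite \<times> 'k) xapoly"
  assumes f: "f \<in> HH 1"
  shows "f \<doteq> level_rank_section (level_rank f)"
proof -
  let ?P = "\<lambda>f :: ('k, 'n \<times> 'k) xapoly. f \<doteq> level_rank_section (level_rank f)"
  have 0: "level_rank_section 0 = 0" by (simp add: level_rank_section_def)
  have scale: "?P (cscale c f)" if "?P f" for c f
    using mpoly.span_scale[of "f - level_rank_section (level_rank f)" _ c] that
    unfolding slk_HH_def level_rank_cscale level_rank_section_cscale mpoly.scale_right_diff_distrib by blast
  have add: "?P (f + g)" if "?P f" "?P g" for f g
    using mpoly.span_add[of "f - level_rank_section (level_rank f)" _ "g - level_rank_section (level_rank g)"] that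
    unfolding slk_HH_def level_rank_add level_rank_section_add add_diff_add by blast
  have color: "?P (color_det u e)" for u e
  proof -
    let ?m = "count_key u (sum e UNIV)"
    have "\<exists>u' e'. (key_rep ?m :: ('k, 'n \<times> 'k) xapoly) = color_det u' e' \<and> ?m = count_key u' (sum e' UNIV)"
      unfolding key_rep_def by (rule someI_ex) (intro exI conjI, rule refl, rule refl)
    then obtain u' e' where "(key_rep ?m :: ('k, 'n \<times> 'k) xapoly) = color_det u' e'"
      "?m = count_key u' (sum e' UNIV)" by (elim exE conjE)
    then have "color_det u e \<doteq> key_rep ?m"
      by (simp add: color_det_cong)
    then show ?thesis
      by (simp add: level_rank_color_det level_rank_section_def)
  qed
  have rowdet: "?P (rowdet r e)" for r e
  proof (cases "surj (snd \<circ> r)")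
    case True
    from rowdet_eq_color_det[OF this] show ?thesis
      by (metis scale color)
  next
    case False
    then have "rowdet r e \<in> slk_HH" by (rule rowdet_in_slk_HH)
    then show ?thesis by (simp add: level_rank_slk_HH 0)
  qed
  have "f \<in> mpoly.span {rowdet r e | r e. True}"
    using f HH_1_subset_span_rowdet by blast
  then show ?thesis
  proof (induction rule: mpoly.span_induct)
    case base
    show ?case
      using add scale by (auto simp: mpoly.subspace_def level_rank_0 0)
  next
    case (step f)
    then show ?case using rowdet by auto
  qed
qed

lemma level_rank_eq_iff:
  assumes "f \<in> HH 1" "g \<in> HH 1"
  shows "level_rank f = level_rank g \<longleftrightarrow> f \<doteq> g"
proof
  assume "level_rank f = level_rank g"
  then show "f \<doteq> g"
    using level_rank_section_cong[OF assms(1)] slk_cong_sym[OF level_rank_section_cong[OF assms(2)]]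
    by (metis slk_cong_trans)
next
  assume "f \<doteq> g"
  then show "level_rank f = level_rank g"
    using level_rank_slk_HH[of "f - g"] by (simp add: level_rank_diff)
qed

section \<open>Coset arithmetic and the induced map on coinvariants\<close>

lemma slk_HH_add: "f \<in> slk_HH \<Longrightarrow> g \<in> slk_HH \<Longrightarrow> f + g \<in> slk_HH"
  and slk_HH_cscale: "f \<in> slk_HH \<Longrightarrow> cscale c f \<in> slk_HH"
  unfolding slk_HH_def by (rule mpoly.span_add mpoly.span_scale; assumption)+

text \<open>Since \<open>level_rank\<close> kills \<open>slk_HH\<close>, the image of a coset is a
  singleton, so \<open>the_elem\<close> returns a genuine value.\<close>

lemma level_rank_bar_coset: "level_rank_bar (f +o slk_HH) = level_rank f"
proof -
  have "level_rank ` (f +o slk_HH) = {level_rank f}"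
  proof
    show "level_rank ` (f +o slk_HH) \<subseteq> {level_rank f}"
      by (auto simp: elt_set_plus_def level_rank_add level_rank_slk_HH)
    have "f \<in> f +o slk_HH"
      by (auto simp: elt_set_plus_def intro!: bexI[of _ 0])
    then show "{level_rank f} \<subseteq> level_rank ` (f +o slk_HH)" by blast
  qed
  then show ?thesis by (simp add: level_rank_bar_def)
qed

lemma slk_coset_eq:
  fixes f g :: "('k::finite, 'n::finite \<times> 'k) xapoly"
  assumes "f \<doteq> g"
  shows "f +o slk_HH = g +o slk_HH"
proof -
  have "f +o slk_HH \<subseteq> g +o slk_HH" if "f \<doteq> g" for f g :: "('k, 'n \<times> 'k) xapoly"
  proof
    fix x assume "x \<in> f +o slk_HH"
    then obtain w where w: "w \<in> slk_HH" "x = f + w" by (auto simp: elt_set_plus_def)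
    then have "x = g + ((f - g) + w)" by simp
    with slk_HH_add[OF that w(1)] show "x \<in> g +o slk_HH"
      unfolding elt_set_plus_def by blast
  qed
  with assms slk_cong_sym show ?thesis by blast
qed

lemma slk_coset_add: "(f +o slk_HH) + (g +o slk_HH) = (f + g) +o slk_HH"
proof -
  have "slk_HH + slk_HH = (slk_HH :: ('a, 'b \<times> 'a) xapoly set)"
  proof
    show "slk_HH + slk_HH \<subseteq> (slk_HH :: ('a, 'b \<times> 'a) xapoly set)"
      by (auto simp: set_plus_def slk_HH_add)
    show "slk_HH \<subseteq> slk_HH + (slk_HH :: ('a, 'b \<times> 'a) xapoly set)"
      by (rule set_zero_plus2) simp
  qed
  then show ?thesis by (simp add: set_plus_rearrange)
qed

lemma slk_coset_scale: "quotient_scale slk_HH c (f +o slk_HH) = cscale c f +o slk_HH"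
proof
  show "quotient_scale slk_HH c (f +o slk_HH) \<subseteq> cscale c f +o slk_HH"
    by (auto simp: quotient_scale_def elt_set_plus_def set_plus_def mpoly.scale_right_distrib add.assoc
        intro!: bexI[of _ "_ + _"] slk_HH_add slk_HH_cscale)
  have f: "f \<in> f +o slk_HH"
    by (auto simp: elt_set_plus_def intro!: bexI[of _ 0])
  show "cscale c f +o slk_HH \<subseteq> quotient_scale slk_HH c (f +o slk_HH)"
  proof
    fix x assume "x \<in> cscale c f +o slk_HH"
    then obtain w where "w \<in> slk_HH" "x = cscale c f + w" by (auto simp: elt_set_plus_def)
    with f show "x \<in> quotient_scale slk_HH c (f +o slk_HH)"
      by (auto simp: quotient_scale_def set_plus_def)
  qed
qed

theorem corollary5p14:
  shows "(\<forall>f \<in> (HH 1 :: ('k::finite, 'n::finite \<times> 'k) xapoly set).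
            level_rank_bar (f +o slk_HH) = level_rank f) \<and>
         quotient_linear_iso
           (HH 1 :: ('k, 'n \<times> 'k) xapoly set)
           slk_HH
           (HH CARD('k) :: (1, 'n) xapoly set)
           level_rank_bar"
proof
  show "\<forall>f \<in> (HH 1 :: ('k, 'n \<times> 'k) xapoly set). level_rank_bar (f +o slk_HH) = level_rank f"
    by (simp add: level_rank_bar_coset)
  let ?V = "HH 1 :: ('k, 'n \<times> 'k) xapoly set"
  show "quotient_linear_iso ?V slk_HH (HH CARD('k)) level_rank_bar"
    unfolding quotient_linear_iso_def
  proof (intro conjI ballI allI)
    show "bij_betw level_rank_bar (quotient_space ?V slk_HH) (HH CARD('k))"
      unfolding bij_betw_def
    proof
      show "inj_on level_rank_bar (quotient_space ?V slk_HH)"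
        by (clarsimp simp: inj_on_def quotient_space_def level_rank_bar_coset level_rank_eq_iff)
          (rule slk_coset_eq)
      show "level_rank_bar ` quotient_space ?V slk_HH = HH CARD('k)"
        using HH_1_subset_level_rank level_rank_in_HH
        by (fastforce simp: quotient_space_def image_image level_rank_bar_coset)
    qed
  next
    fix C D assume "C \<in> quotient_space ?V slk_HH" "D \<in> quotient_space ?V slk_HH"
    then show "level_rank_bar (C + D) = level_rank_bar C + level_rank_bar D"
      by (auto simp: quotient_space_def slk_coset_add level_rank_bar_coset level_rank_add)
  next
    fix c C assume "C \<in> quotient_space ?V slk_HH"
    then show "level_rank_bar (quotient_scale slk_HH c C) = cscale c (level_rank_bar C)"
      by (auto simp: quotient_space_def slk_coset_scale level_rank_bar_coset level_rank_cscale)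
  qed
qed

end
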